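(* Let $n,m\geq1$ with $nm>2$. For every sequence of balls $\Psi=(B_q)_{q\in\mathbb{N}}$ in $\mathbb{R}^m/\mathbb{Z}^m$, \[ |\mathcal{A}_{n,m}(\Psi)|=\begin{cases}0 & \text{if } \sum_{q=1}^\infty q^{n-1}|B_q|<\infty,\\ 1 & \text{if } \sum_{q=1}^\infty q^{n-1}|B_q|=\infty.\end{cases} \]
   Context: For $\mathbf{q}\in\mathbb{Z}^n$, $|\mathbf{q}|=\max_i|q_i|$. Points $\mathbf{x}\in[0,1]^{nm}$ are $n\times m$ matrices and $\mathbf{q}\mathbf{x}\in\mathbb{R}^m$ is the row-vector–matrix product. Balls are max-norm balls in the torus $\mathbb{R}^m/\mathbb{Z}^m$; $|\cdot|$ is Lebesgue measure. $\mathcal{A}_{n,m}(\Psi)$ is the set of $\mathbf{x}\in[0,1]^{nm}$ such that $\mathbf{q}\mathbf{x}+\mathbf{p}\in B_{|\mathbf{q}|}$ (modulo $\mathbb{Z}^m$) for infinitely many pairs $(\mathbf{p},\mathbf{q})\in\mathbb{Z}^m\times(\mathbb{Z}^n\setminus\{\mathbf 0\})$. *)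

theory Defs
  imports "HOL-Analysis.Analysis"
begin

definition qnorm :: "int ^ 'n \<Rightarrow> nat" where
  "qnorm q = Max (range (\<lambda>i. nat \<bar>q $ i\<bar>))"

text \<open>A ball in the torus R^m/Z^m (max-norm), given by a centre c and a radius r,
  represented by its Z^m-periodic preimage in R^m:
  y lies in the ball iff y + p lies in the max-norm ball of centre c, radius r
  for some integer vector p.\<close>
definition torus_ball :: "real ^ 'm \<Rightarrow> real \<Rightarrow> (real ^ 'm) set" where
  "torus_ball c r = {y. \<exists>p :: int ^ 'm. \<forall>i. \<bar>y $ i + of_int (p $ i) - c $ i\<bar> < r}"

definition torus_ball_measure :: "real ^ 'm \<Rightarrow> real \<Rightarrow> real" where
  "torus_ball_measure c r =
     measure lebesgue (torus_ball c r \<inter> {y. \<forall>i. 0 \<le> y $ i \<and> y $ i < 1})"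

definition A_set :: "(nat \<Rightarrow> (real ^ 'm) \<times> real) \<Rightarrow> (real ^ 'm ^ 'n) set" where
  "A_set B = {x \<in> cbox 0 One.
     infinite {q :: int ^ 'n. q \<noteq> 0 \<and>
        ((\<chi> i. real_of_int (q $ i)) v* x) \<in> torus_ball (fst (B (qnorm q))) (snd (B (qnorm q)))}}"

end

theory Submission
  imports Defs "HOL-Probability.Probability_Measure"
begin

text \<open>
  Restrict to the integer vectors \<open>w\<close> whose first coordinate is \<open>k\<close> and whose other coordinates lie in
  \<open>[0, k)\<close>: there are exactly \<open>k ^ (n - 1)\<close> of them, so the sum of the measures of the sets
  \<open>E w = {x. w x \<in> B k}\<close> still diverges. If \<open>w\<close> and \<open>w'\<close> are linearly independent, \<open>E w\<close> and \<open>E w'\<close> are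
  independent, because the cube integral of a periodic function is translation invariant.
  If \<open>w\<close> and \<open>w'\<close> are parallel, of norms \<open>b > a\<close>, averaging over the translates by \<open>1 / d\<close> with
  \<open>d = b / gcd a b\<close> gives \<open>|E w \<inter> E w'| \<le> (|B a| ^ (1 / m) + 1 / d) ^ m |B b|\<close>. The
  main term is that of independent sets, and the terms \<open>|B b| / d ^ m\<close> add up to at most
  \<open>2 b ^ (n - 1) |B b|\<close> for every \<open>b\<close>, since \<open>d\<close> divides all coordinates of \<open>w\<close> and the sum of
  \<open>d\<close> times \<open>d ^ (1 - n - m)\<close> over \<open>d\<close> converges as soon as \<open>n + m \<ge> 4\<close>. The second
  moment of the number of hits is thus asymptotic to the square of the first one, and Chebyshev's inequality
  gives full measure.
\<close>

section \<open>Periodic functions on the unit cube\<close>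

text \<open>Half-open, so that its lattice translates tile the space exactly and not merely up to
  null sets.\<close>

definition ucube :: "'a::euclidean_space set" where
  "ucube = {x. \<forall>b\<in>Basis. 0 \<le> x \<bullet> b \<and> x \<bullet> b < 1}"

text \<open>Coordinates are taken along \<open>Basis\<close>, so that one definition serves vectors
  and matrices alike.\<close>

definition integer_lattice :: "'a::euclidean_space set" where
  "integer_lattice = {x. \<forall>b\<in>Basis. x \<bullet> b \<in> \<int>}"

definition periodic :: "('a::euclidean_space \<Rightarrow> 'b) \<Rightarrow> bool" where
  "periodic f \<longleftrightarrow> (\<forall>x. \<forall>k\<in>integer_lattice. f (x + k) = f x)"

text \<open>With values in \<open>ennreal\<close>, sums and integrals can be exchanged without
  integrability conditions.\<close>

abbreviation cube_integral :: "('a::euclidean_space \<Rightarrow> ennreal) \<Rightarrow> ennreal" where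
  "cube_integral f \<equiv> \<integral>\<^sup>+x. f x * indicator ucube x \<partial>lborel"

lemma ucube_borel [measurable]: "ucube \<in> sets borel"
  unfolding ucube_def by measurable

lemma box_subset_ucube: "box 0 One \<subseteq> ucube"
  by (auto simp: ucube_def mem_box less_imp_le)

lemma ucube_subset_cbox: "ucube \<subseteq> cbox 0 One"
  by (auto simp: ucube_def mem_box less_imp_le)

lemma emeasure_ucube [simp]: "emeasure lborel (ucube :: 'a::euclidean_space set) = 1"
proof (rule antisym)
  have "emeasure lborel (ucube :: 'a set) \<le> emeasure lborel (cbox 0 One :: 'a set)"
    by (rule emeasure_mono[OF ucube_subset_cbox]) auto
  then show "emeasure lborel (ucube :: 'a set) \<le> 1"
    by (simp add: emeasure_lborel_cbox_eq)
  have "emeasure lborel (box 0 One :: 'a set) \<le> emeasure lborel (ucube :: 'a set)"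
    by (rule emeasure_mono[OF box_subset_ucube]) auto
  then show "1 \<le> emeasure lborel (ucube :: 'a set)"
    by (simp add: emeasure_lborel_box_eq)
qed

lemma lattice_uminus: "k \<in> integer_lattice \<Longrightarrow> - k \<in> integer_lattice"
  by (auto simp: integer_lattice_def)

lemma countable_lattice: "countable (integer_lattice :: 'a::euclidean_space set)"
proof (rule countable_subset)
  show "(integer_lattice :: 'a set) \<subseteq> (\<lambda>f. \<Sum>b\<in>Basis. f b *\<^sub>R b) ` (Basis \<rightarrow>\<^sub>E \<int>)"
  proof
    fix x :: 'a assume "x \<in> integer_lattice"
    then have "restrict (\<lambda>b. x \<bullet> b) Basis \<in> Basis \<rightarrow>\<^sub>E \<int>" by (auto simp: integer_lattice_def)
    moreover have "x = (\<Sum>b\<in>Basis. restrict (\<lambda>b. x \<bullet> b) Basis b *\<^sub>R b)"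
      by (simp add: euclidean_representation)
    ultimately show "x \<in> (\<lambda>f. \<Sum>b\<in>Basis. f b *\<^sub>R b) ` (Basis \<rightarrow>\<^sub>E \<int>)" by blast
  qed
  show "countable ((\<lambda>f. \<Sum>b\<in>Basis. f b *\<^sub>R b) ` ((Basis :: 'a set) \<rightarrow>\<^sub>E (\<int> :: real set)))"
    by (intro countable_image countable_PiE) (auto simp: countable_int)
qed

text \<open>The only lattice point that counts is the vector of the floors of the coordinates.
  Writing the count as an integral over a counting measure allows exchanging it with Lebesgue
  integrals.\<close>

lemma lattice_tiling_minus:
  fixes x :: "'a::euclidean_space"
  shows "(\<integral>\<^sup>+k. indicator ucube (x - k) \<partial>count_space integer_lattice) = 1"
proof -
  define k0 where "k0 = (\<Sum>b\<in>Basis. of_int \<lfloor>x \<bullet> b\<rfloor> *\<^sub>R b)"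
  have k0b: "k0 \<bullet> b = of_int \<lfloor>x \<bullet> b\<rfloor>" if "b \<in> Basis" for b
    using that by (simp add: k0_def inner_sum_left_Basis)
  have k0: "k0 \<in> integer_lattice" by (auto simp: integer_lattice_def k0b)
  have iff: "x - k \<in> ucube \<longleftrightarrow> k = k0" if "k \<in> integer_lattice" for k
  proof
    assume a: "x - k \<in> ucube"
    show "k = k0"
    proof (rule euclidean_eqI)
      fix b :: 'a assume b: "b \<in> Basis"
      have "k \<bullet> b \<in> \<int>" using that b by (simp add: integer_lattice_def)
      then obtain n where n: "k \<bullet> b = of_int n" by (rule Ints_cases)
      have "0 \<le> x \<bullet> b - of_int n" "x \<bullet> b - of_int n < 1"
        using a b n by (auto simp: ucube_def inner_diff_left)
      then have "\<lfloor>x \<bullet> b\<rfloor> = n" by linarith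
      then show "k \<bullet> b = k0 \<bullet> b" using n k0b[OF b] by simp
    qed
  next
    assume "k = k0"
    then show "x - k \<in> ucube"
      by (auto simp: ucube_def inner_diff_left k0b) linarith
  qed
  have "(\<integral>\<^sup>+k. indicator ucube (x - k) \<partial>count_space integer_lattice)
      = (\<integral>\<^sup>+k. indicator {k0} k \<partial>count_space integer_lattice)"
    by (intro nn_integral_cong) (auto simp: iff indicator_def)
  also have "\<dots> = 1"
    using k0 by (simp add: nn_integral_indicator_singleton')
  finally show ?thesis .
qed

lemma lattice_tiling_plus:
  fixes x :: "'a::euclidean_space"
  shows "(\<integral>\<^sup>+k. indicator ucube (x + k) \<partial>count_space integer_lattice) = 1"
proof -
  have "bij_betw uminus (integer_lattice :: 'a set) integer_lattice"
    by (rule bij_betwI[of _ _ _ uminus]) (auto simp: lattice_uminus)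
  from nn_integral_bij_count_space[OF this, of "\<lambda>k. indicator ucube (x - k)"]
  show ?thesis by (simp add: lattice_tiling_minus)
qed

lemma nn_integral_lborel_translate:
  fixes f :: "'a::euclidean_space \<Rightarrow> ennreal"
  assumes [measurable]: "f \<in> borel_measurable borel"
  shows "(\<integral>\<^sup>+x. f (x + t) \<partial>lborel) = (\<integral>\<^sup>+x. f x \<partial>lborel)"
proof -
  have "(\<integral>\<^sup>+x. f x \<partial>lborel) = (\<integral>\<^sup>+x. f x \<partial>distr lborel borel ((+) t))"
    by (simp add: lborel_distr_plus)
  also have "\<dots> = (\<integral>\<^sup>+x. f (t + x) \<partial>lborel)"
    by (subst nn_integral_distr) auto
  finally show ?thesis by (simp add: add.commute)
qed

text \<open>The translated cube is cut into pieces by the lattice translates of the cube;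
  periodicity moves each piece back into the cube, and the moved pieces fill it exactly
  once.\<close>

lemma cube_integral_translate:
  fixes f :: "'a::euclidean_space \<Rightarrow> ennreal"
  assumes [measurable]: "f \<in> borel_measurable borel" and per: "periodic f"
  shows "cube_integral (\<lambda>x. f (x + t)) = cube_integral f"
proof -
  let ?I = "indicator ucube :: 'a \<Rightarrow> ennreal"
  have [measurable]: "?I \<in> borel_measurable borel" by measurable
  have "cube_integral (\<lambda>x. f (x + t)) = (\<integral>\<^sup>+x. f x * ?I (x - t) \<partial>lborel)"
    using nn_integral_lborel_translate[of "\<lambda>x. f x * ?I (x - t)" t] by simp
  \<comment> \<open>The inserted sum over \<open>k\<close> of \<open>?I (x + k)\<close> is 1 by the
    tiling property.\<close>
  also have "\<dots> = (\<integral>\<^sup>+x. (\<integral>\<^sup>+k. f x * ?I (x - t) * ?I (x + k) \<partial>count_space integer_lattice) \<partial>lborel)"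
    by (simp add: nn_integral_cmult lattice_tiling_plus)
  also have "\<dots> = (\<integral>\<^sup>+k. (\<integral>\<^sup>+x. f x * ?I (x - t) * ?I (x + k) \<partial>lborel) \<partial>count_space integer_lattice)"
    by (intro nn_integral_count_space_nn_integral countable_lattice) measurable
  also have "\<dots> = (\<integral>\<^sup>+k. (\<integral>\<^sup>+x. f x * ?I (x - t - k) * ?I x \<partial>lborel) \<partial>count_space integer_lattice)"
  proof (rule nn_integral_cong)
    fix k :: 'a assume "k \<in> space (count_space integer_lattice)"
    then have k: "k \<in> integer_lattice" by simp
    have f: "f (x - k) = f x" for x
      using per k by (metis diff_add_cancel periodic_def)
    show "(\<integral>\<^sup>+x. f x * ?I (x - t) * ?I (x + k) \<partial>lborel) = (\<integral>\<^sup>+x. f x * ?I (x - t - k) * ?I x \<partial>lborel)"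
      using nn_integral_lborel_translate[of "\<lambda>x. f x * ?I (x - t) * ?I (x + k)" "- k"]
      by (simp add: f algebra_simps)
  qed
  also have "\<dots> = (\<integral>\<^sup>+x. (\<integral>\<^sup>+k. f x * ?I (x - t - k) * ?I x \<partial>count_space integer_lattice) \<partial>lborel)"
    by (intro nn_integral_count_space_nn_integral[symmetric] countable_lattice) measurable
  also have "\<dots> = cube_integral f"
    by (intro nn_integral_cong)
      (simp add: nn_integral_cmult nn_integral_multc lattice_tiling_minus)
  finally show ?thesis .
qed

text \<open>Shifting along a direction that fixes \<open>F\<close> translates the argument of \<open>g\<close>
  arbitrarily; averaging over all these shifts makes \<open>g\<close> independent of \<open>F\<close>.\<close>

lemma cube_integral_mult_linear:
  fixes F :: "'a::euclidean_space \<Rightarrow> ennreal" and g :: "'b::euclidean_space \<Rightarrow> ennreal"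
  assumes F [measurable]: "F \<in> borel_measurable borel" and g [measurable]: "g \<in> borel_measurable borel"
    and perF: "periodic F" and perg: "periodic g"
    and L: "linear L" and Lk: "\<And>k. k \<in> integer_lattice \<Longrightarrow> L k \<in> integer_lattice"
    and shift: "\<And>s. \<exists>t. L t = s \<and> (\<forall>x. F (x + t) = F x)"
  shows "cube_integral (\<lambda>x. F x * g (L x)) = cube_integral F * cube_integral g"
proof -
  have [measurable]: "L \<in> borel_measurable borel"
    using L by (simp add: linear_continuous_on linear_linear borel_measurable_continuous_onI)
  have [measurable]: "(indicator ucube :: 'a \<Rightarrow> ennreal) \<in> borel_measurable borel"
    "(indicator ucube :: 'b \<Rightarrow> ennreal) \<in> borel_measurable borel" by measurable
  let ?J = "cube_integral (\<lambda>x. F x * g (L x))"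
  have J: "cube_integral (\<lambda>x. F x * g (L x + s)) = ?J" for s
  proof -
    obtain t where t: "L t = s" "\<And>x. F (x + t) = F x" using shift by blast
    have "periodic (\<lambda>x. F x * g (L x))"
      using perF perg Lk by (simp add: periodic_def linear_add[OF L])
    from cube_integral_translate[OF _ this, of t] show ?thesis
      by (simp add: t linear_add[OF L])
  qed
  have "?J = cube_integral (\<lambda>s::'b. ?J)"
    by (simp add: nn_integral_cmult)
  also have "\<dots> = (\<integral>\<^sup>+s. (\<integral>\<^sup>+x. F x * g (L x + s) * indicator ucube x * indicator ucube s \<partial>lborel) \<partial>lborel)"
  proof (rule nn_integral_cong)
    fix s :: 'b
    show "?J * indicator ucube s =
      (\<integral>\<^sup>+x. F x * g (L x + s) * indicator ucube x * indicator ucube s \<partial>lborel)"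
      by (subst J[of s, symmetric], subst nn_integral_multc) auto
  qed
  also have "\<dots> = (\<integral>\<^sup>+x. (\<integral>\<^sup>+s. F x * g (L x + s) * indicator ucube x * indicator ucube s \<partial>lborel) \<partial>lborel)"
    by (intro lborel_pair.Fubini') measurable
  \<comment> \<open>The inner integral over \<open>s\<close> sees \<open>L x\<close> only as a
    translation of \<open>g\<close>, and so does not depend on \<open>x\<close>.\<close>
  also have "\<dots> = (\<integral>\<^sup>+x. (F x * indicator ucube x) * cube_integral (\<lambda>s. g (s + L x)) \<partial>lborel)"
    by (subst nn_integral_cmult[symmetric]) (auto simp: mult_ac add.commute)
  also have "\<dots> = (\<integral>\<^sup>+x. (F x * indicator ucube x) * cube_integral g \<partial>lborel)"
    by (simp add: cube_integral_translate[OF g perg])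
  also have "\<dots> = cube_integral F * cube_integral g"
    by (subst nn_integral_multc) auto
  finally show ?thesis .
qed

text \<open>The case \<open>F = 1\<close>, where every preimage of \<open>s\<close> under
  \<open>L\<close> is an admissible shift.\<close>

corollary cube_integral_linear:
  fixes g :: "'b::euclidean_space \<Rightarrow> ennreal" and L :: "'a::euclidean_space \<Rightarrow> 'b"
  assumes "g \<in> borel_measurable borel" "periodic g" "linear L"
    "\<And>k. k \<in> integer_lattice \<Longrightarrow> L k \<in> integer_lattice" "surj L"
  shows "cube_integral (\<lambda>x. g (L x)) = cube_integral g"
proof -
  have "periodic (\<lambda>x::'a. 1::ennreal)" by (simp add: periodic_def)
  from cube_integral_mult_linear[OF _ assms(1) this assms(2,3)] assms(4,5)
  show ?thesis by (simp add: surj_def) metis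
qed

section \<open>Quasi-independent events\<close>

text \<open>Since the overlaps are asymptotically those of independent events, Chebyshev's inequality
  already gives full measure, and no zero-one law is needed.\<close>

lemma (in prob_space) AE_infinite_of_quasi_independent:
  fixes E :: "'i \<Rightarrow> 'a set" and F :: "nat \<Rightarrow> 'i set" and S :: "nat \<Rightarrow> real"
  assumes fin: "\<And>N. finite (F N)" and E [measurable]: "\<And>i. E i \<in> events"
    and S: "\<And>N. S N = (\<Sum>i\<in>F N. prob (E i))"
    and lim: "filterlim S at_top sequentially"
    and overlap: "\<And>e. e > 0 \<Longrightarrow>
      \<exists>C. \<forall>N. (\<Sum>i\<in>F N. \<Sum>j\<in>F N. prob (E i \<inter> E j)) \<le> (1 + e) * (S N)\<^sup>2 + C * S N"
  shows "AE x in M. infinite {i \<in> (\<Union>N. F N). x \<in> E i}"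
proof -
  define Z where "Z N x = (\<Sum>i\<in>F N. indicator (E i) x :: real)" for N x
  have Zm [measurable]: "Z N \<in> borel_measurable M" for N
    unfolding Z_def by measurable
  have EZ: "expectation (Z N) = S N" for N
    unfolding Z_def S by (subst Bochner_Integration.integral_sum) (auto simp: emeasure_eq_measure)
  have Z2: "(Z N x)\<^sup>2 = (\<Sum>i\<in>F N. \<Sum>j\<in>F N. indicator (E i \<inter> E j) x)" for N x
    by (simp add: Z_def power2_eq_square sum_product indicator_inter_arith)
  have int2: "integrable M (\<lambda>x. (Z N x)\<^sup>2)" for N
    unfolding Z2 by (auto simp: emeasure_eq_measure intro!: Bochner_Integration.integrable_sum)
  have int1: "integrable M (Z N)" for N
    unfolding Z_def by (auto simp: emeasure_eq_measure intro!: Bochner_Integration.integrable_sum)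
  have EZ2: "expectation (\<lambda>x. (Z N x)\<^sup>2) = (\<Sum>i\<in>F N. \<Sum>j\<in>F N. prob (E i \<inter> E j))" for N
    unfolding Z2
    by (subst Bochner_Integration.integral_sum, force simp: emeasure_eq_measure)
      (subst Bochner_Integration.integral_sum, auto simp: emeasure_eq_measure)
  have var: "variance (Z N) = (\<Sum>i\<in>F N. \<Sum>j\<in>F N. prob (E i \<inter> E j)) - (S N)\<^sup>2" for N
    using variance_eq[OF int1[of N] int2[of N]] by (simp add: EZ EZ2)
  \<comment> \<open>A point with finitely many hits has all its hit counts \<open>Z N\<close>
    bounded by some \<open>K\<close>, so it is enough that each of these events is null.\<close>
  have small: "prob {x \<in> space M. \<forall>N. Z N x \<le> real K} = 0" for K :: nat
  proof -
    let ?D = "{x \<in> space M. \<forall>N. Z N x \<le> real K}"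
    have bound: "prob ?D \<le> 8 * e" if e: "e > 0" for e
    proof -
      obtain C where C: "\<And>N. (\<Sum>i\<in>F N. \<Sum>j\<in>F N. prob (E i \<inter> E j)) \<le> (1 + e) * (S N)\<^sup>2 + C * S N"
        using overlap[OF e] by blast
      \<comment> \<open>The bound \<open>2 * K\<close> puts the event at least
        \<open>S N / 2\<close> below the mean, \<open>C / e\<close> absorbs the linear overlap term
        into \<open>e\<close> times the square of \<open>S N\<close>, and 1 keeps the divisor
        positive.\<close>
      have "eventually (\<lambda>N. S N \<ge> max 1 (max (2 * real K) (C / e))) sequentially"
        using lim unfolding filterlim_at_top by (rule spec)
      then obtain N where N: "S N \<ge> 1" "S N \<ge> 2 * real K" "S N \<ge> C / e"
        by (auto simp: eventually_sequentially)
      have CS: "C * S N \<le> e * (S N)\<^sup>2"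
        using N e by (simp add: field_simps power2_eq_square)
      have "prob ?D \<le> prob {x \<in> space M. S N / 2 \<le> \<bar>Z N x - expectation (Z N)\<bar>}"
        using N by (intro finite_measure_mono) (auto simp: EZ, smt (verit) field_sum_of_halves)
      also have "\<dots> \<le> variance (Z N) / (S N / 2)\<^sup>2"
        using N by (intro Chebyshev_inequality int2) auto
      also have "\<dots> \<le> (2 * e * (S N)\<^sup>2) / (S N / 2)\<^sup>2"
        using C[of N] CS by (intro divide_right_mono) (auto simp: var algebra_simps)
      also have "\<dots> = 8 * e"
        using N by (simp add: power2_eq_square field_simps)
      finally show ?thesis .
    qed
    have "prob ?D \<le> 0"
    proof (rule field_le_epsilon)
      fix e :: real assume "e > 0"
      then show "prob ?D \<le> 0 + e" using bound[of "e / 8"] by simp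
    qed
    then show ?thesis by (simp add: measure_le_0_iff)
  qed
  have "AE x in M. \<not> (\<forall>N. Z N x \<le> real K)" for K :: nat
    using small[of K] by (subst AE_iff_measurable[OF _ refl]) (auto simp: emeasure_eq_measure)
  then have "AE x in M. \<forall>K::nat. \<not> (\<forall>N. Z N x \<le> real K)"
    by (simp add: AE_all_countable)
  then show ?thesis
  proof (rule AE_mp, intro AE_I2 impI)
    fix x assume x: "\<forall>K::nat. \<not> (\<forall>N. Z N x \<le> real K)"
    show "infinite {i \<in> (\<Union>N. F N). x \<in> E i}"
    proof
      assume f: "finite {i \<in> (\<Union>N. F N). x \<in> E i}"
      have "Z N x \<le> real (card {i \<in> (\<Union>N. F N). x \<in> E i})" for N
      proof -
        have "Z N x = real (card {i \<in> F N. x \<in> E i})"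
          by (simp add: Z_def indicator_def fin Int_def flip: sum.inter_filter)
        also have "\<dots> \<le> real (card {i \<in> (\<Union>N. F N). x \<in> E i})"
          using f by (intro of_nat_mono card_mono) auto
        finally show ?thesis .
      qed
      then show False using x by blast
    qed
  qed
qed

section \<open>Counting integer vectors\<close>

lemma card_int_vectors_fixed_coordinate:
  fixes i0 :: "'n::finite" and A :: "int set"
  assumes "finite A"
  shows "finite {w :: int ^ 'n. w $ i0 = c \<and> (\<forall>i. i \<noteq> i0 \<longrightarrow> w $ i \<in> A)}" (is "finite ?W")
    and "card {w :: int ^ 'n. w $ i0 = c \<and> (\<forall>i. i \<noteq> i0 \<longrightarrow> w $ i \<in> A)} = card A ^ (CARD('n) - 1)"
proof -
  let ?P = "(UNIV - {i0}) \<rightarrow>\<^sub>E A"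
  have bij: "bij_betw (\<lambda>f. \<chi> i. if i = i0 then c else f i) ?P ?W"
    by (rule bij_betwI[of _ _ _ "\<lambda>w. restrict (\<lambda>i. w $ i) (UNIV - {i0})"])
      (auto simp: vec_eq_iff fun_eq_iff PiE_iff extensional_def)
  have "finite ?P" using assms by (intro finite_PiE) auto
  then show "finite ?W" using bij_betw_finite[OF bij] by simp
  show "card ?W = card A ^ (CARD('n) - 1)"
    using bij_betw_same_card[OF bij] by (simp add: card_PiE)
qed

text \<open>Making one fixed coordinate equal to the norm settles sign and ratio: for positive
  \<open>b\<close> and \<open>a\<close>, members of slabs \<open>b\<close> and \<open>a\<close> can
  be parallel only with ratio \<open>b / a\<close>.\<close>

definition slab :: "'n::finite \<Rightarrow> nat \<Rightarrow> (int ^ 'n) set" where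
  "slab i0 k = {w. w $ i0 = int k \<and> (\<forall>i. i \<noteq> i0 \<longrightarrow> w $ i \<in> {0..<int k})}"

lemma finite_slab [simp]: "finite (slab i0 k)"
  unfolding slab_def by (rule card_int_vectors_fixed_coordinate) simp

lemma card_slab: "card (slab (i0 :: 'n::finite) k) = k ^ (CARD('n) - 1)"
  unfolding slab_def by (subst card_int_vectors_fixed_coordinate) auto

lemma slab_nth: "w \<in> slab i0 k \<Longrightarrow> w $ i0 = int k"
  by (simp add: slab_def)

lemma qnorm_slab:
  assumes "w \<in> slab i0 k"
  shows "qnorm w = k"
proof -
  have "nat \<bar>w $ i\<bar> \<le> k" for i
    using assms by (cases "i = i0") (auto simp: slab_def)
  moreover have "k \<in> range (\<lambda>i. nat \<bar>w $ i\<bar>)"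
    using assms by (intro image_eqI[of _ _ i0]) (auto simp: slab_def)
  ultimately show ?thesis unfolding qnorm_def by (intro Max_eqI) auto
qed

text \<open>Multiplication by \<open>d\<close> maps \<open>slab i0 k\<close> bijectively onto the
  set that is counted.\<close>

lemma card_slab_divisible:
  fixes i0 :: "'n::finite"
  assumes d: "d > 0"
  shows "card {w \<in> slab i0 (d * k). \<forall>i. int d dvd w $ i} = k ^ (CARD('n) - 1)"
proof -
  let ?f = "\<lambda>w :: int ^ 'n. \<chi> i. int d * w $ i"
  have "bij_betw ?f (slab i0 k) {w \<in> slab i0 (d * k). \<forall>i. int d dvd w $ i}"
  proof (rule bij_betwI[of _ _ _ "\<lambda>w. \<chi> i. w $ i div int d"])
    show "(\<lambda>w. \<chi> i. w $ i div int d) \<in> {w \<in> slab i0 (d * k). \<forall>i. int d dvd w $ i} \<rightarrow> slab i0 k"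
    proof
      fix w assume w: "w \<in> {w \<in> slab i0 (d * k). \<forall>i. int d dvd w $ i}"
      have "w $ i div int d < int k" if "i \<noteq> i0" for i
      proof -
        obtain v where "w $ i = int d * v" using w by blast
        moreover from this have "int d * v < int d * int k" using w that by (auto simp: slab_def)
        ultimately show ?thesis using d by simp
      qed
      then show "(\<chi> i. w $ i div int d) \<in> slab i0 k"
        using w d by (auto simp: slab_def pos_imp_zdiv_nonneg_iff)
    qed
  qed (use d in \<open>auto simp: slab_def vec_eq_iff\<close>)
  from bij_betw_same_card[OF this] show ?thesis by (simp add: card_slab)
qed

text \<open>The sphere is covered by the \<open>2 n\<close> faces of a cube, on each of which one
  coordinate is \<open>k\<close> or \<open>-k\<close> and the others take
  \<open>2 k + 1 \<le> 3 k\<close> values.\<close>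

lemma card_qnorm_le:
  fixes k :: nat
  assumes "k > 0"
  shows "finite {q :: int ^ 'n. qnorm q = k}"
    and "card {q :: int ^ 'n. qnorm q = k} \<le> 2 * CARD('n) * 3 ^ (CARD('n) - 1) * k ^ (CARD('n) - 1)"
proof -
  let ?Q = "{q :: int ^ 'n. qnorm q = k}"
  define U where "U = (\<lambda>(i0, s). {w :: int ^ 'n. w $ i0 = s \<and> (\<forall>i. i \<noteq> i0 \<longrightarrow> w $ i \<in> {- int k..int k})})"
  let ?J = "(UNIV :: 'n set) \<times> {int k, - int k}"
  have "card {- int k..int k} = 2 * k + 1" by simp
  then have U: "finite (U p)" "card (U p) = (2 * k + 1) ^ (CARD('n) - 1)" for p
    using card_int_vectors_fixed_coordinate[of "{- int k..int k}" "fst p" "snd p"]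
    by (simp_all add: U_def case_prod_beta)
  have sub: "?Q \<subseteq> (\<Union>p\<in>?J. U p)"
  proof
    fix q :: "int ^ 'n" assume "q \<in> ?Q"
    then have M: "Max (range (\<lambda>i. nat \<bar>q $ i\<bar>)) = k" by (simp add: qnorm_def)
    then have le: "nat \<bar>q $ i\<bar> \<le> k" for i by (metis Max_ge finite finite_imageI rangeI)
    have "k \<in> range (\<lambda>i. nat \<bar>q $ i\<bar>)" using M by (metis Max_in UNIV_not_empty finite finite_imageI image_is_empty)
    then obtain i0 where "nat \<bar>q $ i0\<bar> = k" by auto
    then have "q $ i0 = int k \<or> q $ i0 = - int k" by linarith
    moreover have "q $ i \<in> {- int k..int k}" for i using le[of i] by auto
    ultimately show "q \<in> (\<Union>p\<in>?J. U p)" by (auto simp: U_def)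
  qed
  show "finite ?Q" by (rule finite_subset[OF sub]) (auto simp: U)
  have "card ?Q \<le> card (\<Union>p\<in>?J. U p)" by (rule card_mono[OF _ sub]) (auto simp: U)
  also have "\<dots> \<le> (\<Sum>p\<in>?J. card (U p))" by (rule card_UN_le) simp
  also have "\<dots> = card ?J * (2 * k + 1) ^ (CARD('n) - 1)" by (simp add: U)
  also have "\<dots> \<le> card ?J * (3 * k) ^ (CARD('n) - 1)"
    using assms by (intro mult_left_mono power_mono) auto
  also have "card ?J = 2 * CARD('n)"
    using assms by (simp add: card_cartesian_product)
  finally show "card ?Q \<le> 2 * CARD('n) * 3 ^ (CARD('n) - 1) * k ^ (CARD('n) - 1)"
    by (simp add: power_mult_distrib mult_ac)
qed

text \<open>The correction \<open>1 / b\<close> carries the induction: the new term is at most the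
  telescoping difference \<open>1 / b - 1 / (b + 1)\<close>.\<close>

lemma sum_inverse_squares_le: "b > 0 \<Longrightarrow> (\<Sum>d=1..b. 1 / (real d)\<^sup>2) \<le> 2 - 1 / real b"
proof (induction b rule: nat_induct_non_zero)
  case (Suc b)
  have "1 / (real (Suc b))\<^sup>2 \<le> 1 / (real b * real (Suc b))"
    unfolding power2_eq_square using Suc.hyps by (intro divide_left_mono mult_right_mono) auto
  also have "\<dots> = 1 / real b - 1 / real (Suc b)"
    using Suc.hyps by (simp add: field_simps)
  finally show ?case using Suc.IH by simp
qed simp

text \<open>Reducing \<open>a / b\<close> to lowest terms \<open>c / d\<close> turns the sum into one over Farey fractions,
  with at most \<open>d\<close> of them for each denominator.\<close>

lemma sum_gcd_power_le:
  assumes s: "3 \<le> s" and b: "b > 0"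
  shows "(\<Sum>a=1..<b. (real (gcd a b) / real b) ^ s) \<le> 2"
proof -
  let ?h = "\<lambda>a. (b div gcd a b, a div gcd a b)"
  have inj: "inj_on ?h {1..<b}"
  proof (rule inj_onI)
    fix a a' assume a: "a \<in> {1..<b}" "a' \<in> {1..<b}" and e: "?h a = ?h a'"
    have e1: "b div gcd a b = b div gcd a' b" and e2: "a div gcd a b = a' div gcd a' b" using e by auto
    \<comment> \<open>As \<open>b\<close> is fixed, the reduced denominator determines the gcd, and
      then the reduced numerator determines \<open>a\<close>.\<close>
    have "(b div gcd a b) * gcd a b = (b div gcd a b) * gcd a' b"
      by (subst (2) e1) simp
    moreover have "b div gcd a b > 0" using b by (simp add: div_greater_zero_iff gcd_le2_nat)
    ultimately have g: "gcd a b = gcd a' b" by (meson nat_mult_eq_cancel1)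
    have "a = (a div gcd a b) * gcd a b" by simp
    also have "\<dots> = (a' div gcd a' b) * gcd a' b" by (rule arg_cong2[OF e2 g])
    also have "\<dots> = a'" by simp
    finally show "a = a'" .
  qed
  have sub: "?h ` {1..<b} \<subseteq> (SIGMA d:{1..b}. {0..<d})"
  proof (rule image_subsetI)
    fix a assume a: "a \<in> {1..<b}"
    have g: "gcd a b dvd b" "gcd a b dvd a" "gcd a b > 0" using b by auto
    have "b div gcd a b > 0" using b by (simp add: div_greater_zero_iff gcd_le2_nat)
    moreover have "a div gcd a b < b div gcd a b"
      using a g by (intro div_less_mono) auto
    ultimately show "?h a \<in> (SIGMA d:{1..b}. {0..<d})" by simp
  qed
  have "(\<Sum>a=1..<b. (real (gcd a b) / real b) ^ s) = (\<Sum>a=1..<b. (1 / real (fst (?h a))) ^ s)"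
  proof (rule sum.cong)
    fix a assume "a \<in> {1..<b}"
    show "(real (gcd a b) / real b) ^ s = (1 / real (fst (?h a))) ^ s"
      by (simp add: real_of_nat_div)
  qed simp
  also have "\<dots> = (\<Sum>p\<in>?h ` {1..<b}. (1 / real (fst p)) ^ s)"
    by (subst sum.reindex[OF inj]) simp
  \<comment> \<open>Enlarges the index set to all numerators below \<open>d\<close>, coprime or not;
    the summand depends on \<open>d\<close> alone.\<close>
  also have "\<dots> \<le> (\<Sum>p\<in>(SIGMA d:{1..b}. {0..<d}). (1 / real (fst p)) ^ s)"
    by (rule sum_mono2[OF _ sub]) auto
  also have "\<dots> = (\<Sum>d=1..b. real d * (1 / real d) ^ s)"
    using sum.Sigma[of "{1..b}" "\<lambda>d. {0..<d}" "\<lambda>d c. (1 / real d) ^ s"]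
    by (simp add: case_prod_beta)
  also have "\<dots> \<le> (\<Sum>d=1..b. 1 / (real d)\<^sup>2)"
  proof (rule sum_mono)
    fix d assume d: "d \<in> {1..b}"
    have "(1 / real d) ^ s \<le> (1 / real d) ^ 3"
      using d s by (intro power_decreasing) auto
    then have "real d * (1 / real d) ^ s \<le> real d * (1 / real d) ^ 3"
      by (intro mult_left_mono) auto
    also have "\<dots> = 1 / (real d)\<^sup>2" using d by (simp add: power2_eq_square power3_eq_cube)
    finally show "real d * (1 / real d) ^ s \<le> 1 / (real d)\<^sup>2" .
  qed
  also have "\<dots> \<le> 2 - 1 / real b" using b by (rule sum_inverse_squares_le)
  also have "\<dots> \<le> 2" by simp
  finally show ?thesis .
qed

section \<open>Parallel integer vectors\<close>

definition parallel_vecs :: "int ^ 'n \<Rightarrow> nat \<Rightarrow> int ^ 'n \<Rightarrow> nat \<Rightarrow> bool" where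
  "parallel_vecs w b w' a \<longleftrightarrow> (\<forall>i. int a * w $ i = int b * w' $ i)"

text \<open>After division by the gcd the two factors are coprime, so \<open>b div gcd a b\<close>
  must divide every coordinate of \<open>w\<close>; the quotient is \<open>u\<close>.\<close>

lemma parallel_common_factor:
  assumes par: "parallel_vecs w b w' a" and b: "b > 0"
  obtains u where "\<And>i. w $ i = int (b div gcd a b) * u $ i" "\<And>i. w' $ i = int (a div gcd a b) * u $ i"
proof -
  define g a' b' where "g = gcd a b" and "a' = a div g" and "b' = b div g"
  have ab: "a = g * a'" "b = g * b'" by (auto simp: g_def a'_def b'_def)
  have g0: "g > 0" using b by (simp add: g_def)
  have b0: "b' > 0" using b ab(2) by (cases b') auto
  have cop: "coprime (int b') (int a')"
    using b by (simp add: a'_def b'_def g_def div_gcd_coprime coprime_commute)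
  have eq: "int a' * w $ i = int b' * w' $ i" for i
  proof -
    have "int g * (int a' * w $ i) = int g * (int b' * w' $ i)"
      using par unfolding parallel_vecs_def ab by (auto simp: mult.assoc)
    then show ?thesis using g0 by simp
  qed
  have dvd: "int b' dvd w $ i" for i
    using eq[of i] cop by (metis coprime_dvd_mult_right_iff dvd_triv_left)
  define u where "u = (\<chi> i. w $ i div int b')"
  have w: "w $ i = int b' * u $ i" for i using dvd[of i] by (simp add: u_def)
  have "w' $ i = int a' * u $ i" for i
  proof -
    have "int b' * w' $ i = int b' * (int a' * u $ i)"
      unfolding eq[of i, symmetric] w[of i] by (simp only: mult.left_commute)
    then show ?thesis using b0 by simp
  qed
  with w show ?thesis by (intro that[of u]) (auto simp: a'_def b'_def g_def)
qed

text \<open>With \<open>d = b div gcd a b\<close>, a vector \<open>w\<close> has at most one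
  parallel partner in \<open>slab i0 a\<close>, and only if \<open>d\<close> divides all its
  coordinates; there are \<open>gcd a b ^ (n - 1)\<close> such \<open>w\<close>. What remains is a
  sum of powers with exponent \<open>n - 1 + m\<close>, which is at least 3.\<close>

lemma sum_parallel_le:
  fixes i0 :: "'n::finite"
  assumes nm: "CARD('n) + m \<ge> 4" and b: "b > 0"
  shows "(\<Sum>w\<in>slab i0 b. \<Sum>a=1..<b. \<Sum>w'\<in>slab i0 a.
      if parallel_vecs w b w' a then (real (gcd a b) / real b) ^ m else 0) \<le> 2 * real b ^ (CARD('n) - 1)"
proof -
  let ?n = "CARD('n) - 1"
  let ?r = "\<lambda>a. real (gcd a b) / real b"
  let ?dv = "\<lambda>w a. \<forall>i. int (b div gcd a b) dvd w $ i"
  have n: "CARD('n) \<ge> 1" by (simp add: Suc_leI)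
  \<comment> \<open>Turns the count \<open>g ^ N\<close> of vectors into \<open>N\<close> further
    factors \<open>g / b\<close>, at the price of \<open>b ^ N\<close>.\<close>
  have scale: "real (g ^ N) * (real g / real b) ^ m = real b ^ N * (real g / real b) ^ (N + m)" for g N :: nat
    using b by (simp add: power_add power_divide)
  have one: "(\<Sum>w'\<in>slab i0 a. if parallel_vecs w b w' a then ?r a ^ m else 0) \<le> (if ?dv w a then ?r a ^ m else 0)"
    if a: "a \<in> {1..<b}" for w a
  proof (cases "\<exists>w'\<in>slab i0 a. parallel_vecs w b w' a")
    case True
    then obtain w' where w': "w' \<in> slab i0 a" "parallel_vecs w b w' a" by blast
    obtain u where "\<And>i. w $ i = int (b div gcd a b) * u $ i"
      using parallel_common_factor[OF w'(2) b] by metis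
    then have dv: "?dv w a" by (metis dvd_triv_left)
    have "w'' = w'" if "parallel_vecs w b w'' a" for w''
      using that w'(2) b by (auto simp: parallel_vecs_def vec_eq_iff)
    then have "{w'' \<in> slab i0 a. parallel_vecs w b w'' a} = {w'}" using w' by blast
    then have "(\<Sum>w'\<in>slab i0 a. if parallel_vecs w b w' a then ?r a ^ m else 0) = ?r a ^ m"
      by (subst sum.inter_filter[symmetric]) auto
    then show ?thesis using dv by simp
  next
    case False
    then have "(\<Sum>w'\<in>slab i0 a. if parallel_vecs w b w' a then ?r a ^ m else 0) = 0"
      by (intro sum.neutral) auto
    then show ?thesis by simp
  qed
  have "(\<Sum>w\<in>slab i0 b. \<Sum>a=1..<b. \<Sum>w'\<in>slab i0 a. if parallel_vecs w b w' a then ?r a ^ m else 0)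
      \<le> (\<Sum>w\<in>slab i0 b. \<Sum>a=1..<b. if ?dv w a then ?r a ^ m else 0)"
    by (intro sum_mono one)
  also have "\<dots> = (\<Sum>a=1..<b. \<Sum>w\<in>slab i0 b. if ?dv w a then ?r a ^ m else 0)"
    by (rule sum.swap)
  also have "\<dots> = (\<Sum>a=1..<b. real (card {w\<in>slab i0 b. ?dv w a}) * ?r a ^ m)"
    by (subst sum.inter_filter[symmetric]) auto
  also have "\<dots> = (\<Sum>a=1..<b. real b ^ ?n * ?r a ^ (?n + m))"
  proof (rule sum.cong)
    fix a assume a: "a \<in> {1..<b}"
    have bb: "b = (b div gcd a b) * gcd a b" by simp
    have "b div gcd a b > 0" using b by (simp add: div_greater_zero_iff gcd_le2_nat)
    from card_slab_divisible[OF this, of i0 "gcd a b"]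
    have card: "card {w\<in>slab i0 b. ?dv w a} = gcd a b ^ ?n" by (simp only: bb[symmetric])
    show "real (card {w\<in>slab i0 b. ?dv w a}) * ?r a ^ m = real b ^ ?n * ?r a ^ (?n + m)"
      unfolding card by (rule scale)
  qed simp
  also have "\<dots> = real b ^ ?n * (\<Sum>a=1..<b. ?r a ^ (?n + m))"
    by (simp add: sum_distrib_left)
  also have "\<dots> \<le> real b ^ ?n * 2"
    using nm n b by (intro mult_left_mono sum_gcd_power_le) auto
  finally show ?thesis by simp
qed

section \<open>Balls in the torus\<close>

lemma Basis_vec_real: "(Basis :: (real ^ 'm) set) = range (\<lambda>i. axis i 1)"
  by (auto simp: Basis_vec_def)

lemma lattice_vec_iff: "k \<in> integer_lattice \<longleftrightarrow> (\<forall>i. k $ i \<in> \<int>)" for k :: "real ^ 'm"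
  by (simp add: integer_lattice_def Basis_vec_real inner_axis)

lemma lattice_matrix_iff: "k \<in> integer_lattice \<longleftrightarrow> (\<forall>i j. k $ i $ j \<in> \<int>)" for k :: "real ^ 'm ^ 'n"
  by (auto simp: integer_lattice_def Basis_vec_def inner_axis)

lemma ucube_vec: "ucube = {y :: real ^ 'm. \<forall>i. 0 \<le> y $ i \<and> y $ i < 1}"
  by (simp add: ucube_def Basis_vec_real inner_axis)

text \<open>The components of the integer vector can be chosen one by one, so a max-norm ball is a
  product of arcs.\<close>

lemma torus_ball_iff: "y \<in> torus_ball c r \<longleftrightarrow> (\<forall>i. \<exists>p :: int. \<bar>y $ i + of_int p - c $ i\<bar> < r)"
proof
  assume "\<forall>i. \<exists>p :: int. \<bar>y $ i + of_int p - c $ i\<bar> < r"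
  then obtain p :: "'a \<Rightarrow> int" where "\<forall>i. \<bar>y $ i + of_int (p i) - c $ i\<bar> < r" by metis
  then show "y \<in> torus_ball c r"
    by (auto simp: torus_ball_def intro!: exI[of _ "\<chi> i. p i"])
qed (auto simp: torus_ball_def)

lemma torus_ball_add_lattice:
  assumes "k \<in> integer_lattice"
  shows "y + k \<in> torus_ball c r \<longleftrightarrow> y \<in> torus_ball c r"
proof -
  have *: "(\<exists>p :: int. \<bar>(y + k) $ i + of_int p - c $ i\<bar> < r) \<longleftrightarrow>
      (\<exists>p :: int. \<bar>y $ i + of_int p - c $ i\<bar> < r)" for i
  proof -
    obtain n where n: "k $ i = of_int n"
      using assms by (auto simp: lattice_vec_iff elim!: allE[of _ i] Ints_cases)
    show ?thesis
    proof
      assume "\<exists>p :: int. \<bar>(y + k) $ i + of_int p - c $ i\<bar> < r"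
      then obtain p :: int where "\<bar>(y + k) $ i + of_int p - c $ i\<bar> < r" by blast
      then show "\<exists>p :: int. \<bar>y $ i + of_int p - c $ i\<bar> < r"
        by (intro exI[of _ "p + n"]) (simp add: n algebra_simps)
    next
      assume "\<exists>p :: int. \<bar>y $ i + of_int p - c $ i\<bar> < r"
      then obtain p :: int where "\<bar>y $ i + of_int p - c $ i\<bar> < r" by blast
      then show "\<exists>p :: int. \<bar>(y + k) $ i + of_int p - c $ i\<bar> < r"
        by (intro exI[of _ "p - n"]) (simp add: n algebra_simps)
    qed
  qed
  show ?thesis unfolding torus_ball_iff * ..
qed

lemma periodic_torus_ball: "periodic (indicator (torus_ball c r))"
  by (simp add: periodic_def indicator_def torus_ball_add_lattice)

lemma open_torus_ball: "open (torus_ball c r :: (real ^ 'm) set)"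
proof -
  have "torus_ball c r = (\<Union>p :: int ^ 'm. \<Inter>i. {y. \<bar>y $ i + of_int (p $ i) - c $ i\<bar> < r})"
    by (auto simp: torus_ball_def)
  moreover have "open \<dots>"
    by (intro open_UN open_INT ballI finite_class.finite_UNIV open_Collect_less continuous_intros)
  ultimately show ?thesis by simp
qed

lemma torus_ball_borel [measurable]: "torus_ball c r \<in> sets borel"
  using open_torus_ball by (rule borel_open)

lemma torus_ball_empty: "r \<le> 0 \<Longrightarrow> torus_ball c r = {}"
  by (auto simp: torus_ball_def not_less intro: order_trans)

lemma torus_ball_measure_nonneg: "0 \<le> torus_ball_measure c r"
  by (simp add: torus_ball_measure_def)

text \<open>Links Borel integrals to the completed measure in \<open>torus_ball_measure\<close>; the
  two agree on Borel sets.\<close>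

lemma cube_integral_torus_ball:
  fixes c :: "real ^ 'a"
  shows
  "cube_integral (indicator (torus_ball c r)) = ennreal (torus_ball_measure c r)"
proof -
  have [measurable]: "torus_ball c r \<inter> ucube \<in> sets borel" by measurable
  have "emeasure lborel (torus_ball c r \<inter> ucube) \<le> emeasure lborel (ucube :: (real ^ 'a) set)"
    by (rule emeasure_mono) auto
  then have fin: "emeasure lborel (torus_ball c r \<inter> ucube) \<noteq> \<infinity>" by (auto simp: top_unique)
  have "cube_integral (indicator (torus_ball c r)) = (\<integral>\<^sup>+x. indicator (torus_ball c r \<inter> ucube) x \<partial>lborel)"
    by (simp add: indicator_inter_arith)
  also have "\<dots> = ennreal (measure lborel (torus_ball c r \<inter> ucube))"
    using fin by (simp add: emeasure_eq_ennreal_measure)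
  also have "measure lborel (torus_ball c r \<inter> ucube) = torus_ball_measure c r"
    unfolding torus_ball_measure_def ucube_vec[symmetric] by (simp add: measure_completion)
  finally show ?thesis .
qed

text \<open>Here \<open>min 1 (2 * r)\<close> is the length of an arc of radius \<open>r\<close>.
  The bound converts overlap estimates by arc lengths into estimates by measures of balls.\<close>

lemma torus_ball_measure_ge:
  fixes c :: "real ^ 'm"
  assumes r: "r > 0"
  shows "min 1 (2 * r) ^ CARD('m) \<le> torus_ball_measure c r"
proof -
  \<comment> \<open>Capped at \<open>1/2\<close> so that the box of side \<open>2 * \<rho>\<close>
    about the centre of the unit cube stays inside the cube.\<close>
  define \<rho> where "\<rho> = min (1/2) r"
  have \<rho>: "\<rho> > 0" "\<rho> \<le> 1/2" "\<rho> \<le> r" using r by (auto simp: \<rho>_def)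
  define l u where "l = (\<chi> i :: 'm. 1/2 - \<rho>)" and "u = (\<chi> i :: 'm. 1/2 + \<rho>)"
  have le: "\<forall>b\<in>Basis. l \<bullet> b \<le> u \<bullet> b"
    using \<rho> by (auto simp: l_def u_def Basis_vec_real inner_axis)
  have "emeasure lborel (box l u) = (\<Prod>b\<in>Basis. (u - l) \<bullet> b)"
    using le by (simp add: emeasure_lborel_box)
  also have "(\<Prod>b\<in>Basis. (u - l) \<bullet> b) = (\<Prod>b\<in>(Basis :: (real ^ 'm) set). 2 * \<rho>)"
    by (intro prod.cong) (auto simp: l_def u_def Basis_vec_real inner_axis)
  also have "\<dots> = (2 * \<rho>) ^ CARD('m)" by simp
  also have "2 * \<rho> = min 1 (2 * r)" by (auto simp: \<rho>_def)
  finally have "ennreal (min 1 (2 * r) ^ CARD('m)) = (\<integral>\<^sup>+x. indicator (box l u) x \<partial>lborel)" by simp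
  \<comment> \<open>The translation takes the centre of the cube to \<open>c\<close>, hence the box
    into the ball.\<close>
  also have "\<dots> \<le> cube_integral (\<lambda>x. indicator (torus_ball c r) (x + (c - (\<chi> i. 1/2))))"
  proof (rule nn_integral_mono)
    fix x :: "real ^ 'm"
    show "(indicator (box l u) x :: ennreal) \<le>
      indicator (torus_ball c r) (x + (c - (\<chi> i. 1/2))) * indicator ucube x"
    proof (cases "x \<in> box l u")
      case True
      then have x: "1/2 - \<rho> < x $ i" "x $ i < 1/2 + \<rho>" for i
        by (auto simp: mem_box_cart l_def u_def)
      have "x \<in> ucube"
        using x \<rho> unfolding ucube_vec by (smt (verit) mem_Collect_eq field_sum_of_halves)
      moreover have "x + (c - (\<chi> i. 1/2)) \<in> torus_ball c r"
        unfolding torus_ball_iff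
      proof (intro allI exI[of _ 0])
        fix i show "\<bar>(x + (c - (\<chi> i. 1/2))) $ i + of_int 0 - c $ i\<bar> < r"
          using x[of i] \<rho> by (simp add: abs_less_iff)
      qed
      ultimately show ?thesis by (simp add: indicator_def)
    qed simp
  qed
  also have "\<dots> = ennreal (torus_ball_measure c r)"
    by (subst cube_integral_translate[OF _ periodic_torus_ball]) (auto simp: cube_integral_torus_ball)
  finally show ?thesis by (simp add: ennreal_le_iff torus_ball_measure_nonneg)
qed

section \<open>Grid points in a ball, and overlaps of dilated balls\<close>

lemma card_arc_points_le:
  fixes b :: nat and z c r :: real
  assumes b: "b > 0" and r: "r > 0"
  shows "real (card {k \<in> {..<b}. \<exists>p :: int. \<bar>z + real k / real b + of_int p - c\<bar> < r})
    \<le> min 1 (2 * r) * real b + 1" (is "real (card ?S) \<le> _")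
proof (cases "2 * r \<ge> 1")
  case True
  have "card ?S \<le> card {..<b}" by (rule card_mono) auto
  then have "real (card ?S) \<le> real b" by simp
  then show ?thesis using True by simp
next
  case False
  define lo hi where "lo = real b * (c - z - r)" and "hi = real b * (c - z + r)"
  let ?J = "{\<lfloor>lo\<rfloor> + 1..\<lceil>hi\<rceil> - 1}"
  have lohi: "hi - lo = 2 * r * real b" by (simp add: lo_def hi_def algebra_simps)
  \<comment> \<open>After multiplication by \<open>b\<close>, the condition on \<open>k\<close> says
    that the integer \<open>k + p * b\<close> lies strictly between \<open>lo\<close> and
    \<open>hi\<close>; \<open>k\<close> is its residue modulo \<open>b\<close>.\<close>
  have "?S \<subseteq> (\<lambda>j. nat (j mod int b)) ` ?J"
  proof
    fix k assume "k \<in> ?S"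
    then obtain p :: int where k: "k < b" and p: "\<bar>z + real k / real b + of_int p - c\<bar> < r" by auto
    define j where "j = int k + p * int b"
    have j: "of_int j = real b * (real k / real b + of_int p)"
      using b by (simp add: j_def field_simps)
    have "lo < of_int j" "of_int j < hi"
      unfolding lo_def hi_def j using b p by (auto intro!: mult_strict_left_mono)
    then have "j \<in> ?J" by (auto simp: floor_less_iff less_ceiling_iff) linarith+
    moreover have "k = nat (j mod int b)" using k by (simp add: j_def)
    ultimately show "k \<in> (\<lambda>j. nat (j mod int b)) ` ?J" by blast
  qed
  then have "card ?S \<le> card ?J"
    by (meson card_image_le card_mono finite_atLeastAtMost_int finite_imageI le_trans)
  moreover have "real (card ?J) \<le> hi - lo + 1"
  proof -
    \<comment> \<open>The sign keeps the bound valid when \<open>?J\<close> is empty and its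
      cardinality is cut off at 0.\<close>
    have "hi - lo \<ge> 0" using lohi r by simp
    then show ?thesis by simp linarith
  qed
  ultimately show ?thesis using lohi False by simp
qed

text \<open>Grid and ball are both products over the coordinates, so the count is a product of
  one-dimensional counts.\<close>

lemma card_torus_grid_le:
  fixes z c :: "real ^ 'm"
  assumes b: "b > 0" and r: "r > 0"
  shows "real (card {\<kappa> \<in> UNIV \<rightarrow>\<^sub>E {..<b}. z + (\<chi> i. real (\<kappa> i) / real b) \<in> torus_ball c r})
    \<le> (min 1 (2 * r) * real b + 1) ^ CARD('m)"
proof -
  let ?S = "\<lambda>i. {k \<in> {..<b}. \<exists>p :: int. \<bar>z $ i + real k / real b + of_int p - c $ i\<bar> < r}"
  have "{\<kappa> \<in> UNIV \<rightarrow>\<^sub>E {..<b}. z + (\<chi> i. real (\<kappa> i) / real b) \<in> torus_ball c r} = Pi\<^sub>E UNIV ?S"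
    by (auto simp: torus_ball_iff PiE_iff)
  then have "real (card {\<kappa> \<in> UNIV \<rightarrow>\<^sub>E {..<b}. z + (\<chi> i. real (\<kappa> i) / real b) \<in> torus_ball c r})
      = (\<Prod>i\<in>UNIV. real (card (?S i)))"
    by (simp add: card_PiE)
  also have "\<dots> \<le> (\<Prod>i\<in>(UNIV :: 'm set). min 1 (2 * r) * real b + 1)"
    by (intro prod_mono conjI card_arc_points_le b r) auto
  finally show ?thesis by simp
qed

text \<open>Averaging over the translates of \<open>y\<close> by \<open>e \<kappa> / b\<close> with \<open>a e = 1\<close> modulo \<open>b\<close> leaves the
  second factor fixed and moves the argument of the first one through the grid of mesh \<open>1 / b\<close>.\<close>

lemma torus_ball_overlap_coprime:
  fixes c c' :: "real ^ 'm"
  assumes cop: "coprime a b" and b: "b > 0" and r: "r > 0"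
  shows "cube_integral (\<lambda>y. indicator (torus_ball c r) (real a *\<^sub>R y)
        * indicator (torus_ball c' r') (real b *\<^sub>R y))
    \<le> ennreal ((min 1 (2 * r) + 1 / real b) ^ CARD('m) * torus_ball_measure c' r')"
    (is "cube_integral ?h \<le> _")
proof -
  let ?T = "indicator (torus_ball c r) :: real ^ 'm \<Rightarrow> ennreal"
  let ?T' = "indicator (torus_ball c' r') :: real ^ 'm \<Rightarrow> ennreal"
  let ?K = "UNIV \<rightarrow>\<^sub>E {..<b} :: ('m \<Rightarrow> nat) set"
  let ?C = "(min 1 (2 * r) * real b + 1) ^ CARD('m)"
  have [measurable]: "?T \<in> borel_measurable borel" "?T' \<in> borel_measurable borel"
      "(indicator ucube :: real ^ 'm \<Rightarrow> ennreal) \<in> borel_measurable borel"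
    by measurable
  have h [measurable]: "?h \<in> borel_measurable borel" by measurable
  have finK: "finite ?K" by (intro finite_PiE) auto
  have cardK: "card ?K = b ^ CARD('m)" by (simp add: card_PiE)
  obtain e q :: int where eq: "e * int a + q * int b = 1"
    using cop bezout_int[of "int a" "int b"] by auto
  have ae: "\<exists>k\<in>integer_lattice. (\<chi> i. of_int (int a * e * int (\<kappa> i)) / real b) = (\<chi> i. real (\<kappa> i) / real b) + k"
    for \<kappa> :: "'m \<Rightarrow> nat"
  proof -
    have ae: "int a * e = 1 - q * int b" using eq by (simp add: algebra_simps)
    have "of_int (int a * e * int (\<kappa> i)) / real b = real (\<kappa> i) / real b + of_int (- q * int (\<kappa> i))" for i
      unfolding ae using b by (simp add: field_simps)
    then show ?thesis
      by (intro bexI[of _ "\<chi> i. of_int (- q * int (\<kappa> i))"]) (auto simp: vec_eq_iff lattice_vec_iff)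
  qed
  have scale: "real d *\<^sub>R k \<in> integer_lattice" if "k \<in> integer_lattice" for d :: nat and k :: "real ^ 'm"
    using that by (auto simp: lattice_vec_iff)
  have perh: "periodic ?h"
    using scale by (auto simp: periodic_def scaleR_add_right indicator_def torus_ball_add_lattice)
  have shift: "?h (y + (\<chi> i. of_int (e * int (\<kappa> i)) / real b))
      = ?T (real a *\<^sub>R y + (\<chi> i. real (\<kappa> i) / real b)) * ?T' (real b *\<^sub>R y)" for y and \<kappa> :: "'m \<Rightarrow> nat"
  proof -
    obtain k where k: "k \<in> integer_lattice" "(\<chi> i. of_int (int a * e * int (\<kappa> i)) / real b) = (\<chi> i. real (\<kappa> i) / real b) + k"
      using ae by blast
    have 1: "real a *\<^sub>R (y + (\<chi> i. of_int (e * int (\<kappa> i)) / real b))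
        = real a *\<^sub>R y + (\<chi> i. real (\<kappa> i) / real b) + k"
      by (simp only: add.assoc k(2)[symmetric]) (simp add: vec_eq_iff algebra_simps)
    have 2: "real b *\<^sub>R (y + (\<chi> i. of_int (e * int (\<kappa> i)) / real b)) = real b *\<^sub>R y + (\<chi> i. of_int (e * int (\<kappa> i)))"
      using b by (simp add: vec_eq_iff algebra_simps)
    have "(\<chi> i. of_int (e * int (\<kappa> i))) \<in> (integer_lattice :: (real ^ 'm) set)" by (simp add: lattice_vec_iff)
    then show ?thesis
      unfolding 1 2 using k(1) by (simp add: indicator_def torus_ball_add_lattice)
  qed
  \<comment> \<open>All \<open>b ^ m\<close> translates of \<open>?h\<close> have the same cube
    integral.\<close>
  have "of_nat (b ^ CARD('m)) * cube_integral ?h = (\<Sum>\<kappa>\<in>?K. cube_integral ?h)"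
    by (simp add: cardK)
  also have "\<dots> = (\<Sum>\<kappa>\<in>?K. cube_integral (\<lambda>y. ?h (y + (\<chi> i. of_int (e * int (\<kappa> i)) / real b))))"
    by (simp only: cube_integral_translate[OF h perh])
  also have "\<dots> = (\<integral>\<^sup>+y. (\<Sum>\<kappa>\<in>?K. ?T (real a *\<^sub>R y + (\<chi> i. real (\<kappa> i) / real b))
      * ?T' (real b *\<^sub>R y) * indicator ucube y) \<partial>lborel)"
    by (subst nn_integral_sum) (auto simp only: shift, measurable)
  \<comment> \<open>For fixed \<open>y\<close>, the sum over \<open>\<kappa>\<close> of the first
    factor counts the translated grid points in the first ball.\<close>
  also have "\<dots> \<le> (\<integral>\<^sup>+y. ennreal ?C * (?T' (real b *\<^sub>R y) * indicator ucube y) \<partial>lborel)"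
  proof (rule nn_integral_mono)
    fix y :: "real ^ 'm"
    let ?S = "{\<kappa> \<in> ?K. real a *\<^sub>R y + (\<chi> i. real (\<kappa> i) / real b) \<in> torus_ball c r}"
    have "(\<Sum>\<kappa>\<in>?K. ?T (real a *\<^sub>R y + (\<chi> i. real (\<kappa> i) / real b))) = (\<Sum>\<kappa>\<in>?S. 1)"
      by (subst sum.inter_filter[OF finK]) (auto simp: indicator_def intro!: sum.cong)
    also have "\<dots> = ennreal (real (card ?S))" by (simp add: ennreal_of_nat_eq_real_of_nat)
    also have "\<dots> \<le> ennreal ?C" by (intro ennreal_leI card_torus_grid_le b r)
    finally show "(\<Sum>\<kappa>\<in>?K. ?T (real a *\<^sub>R y + (\<chi> i. real (\<kappa> i) / real b))
        * ?T' (real b *\<^sub>R y) * indicator ucube y)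
      \<le> ennreal ?C * (?T' (real b *\<^sub>R y) * indicator ucube y)"
      by (simp only: mult.assoc sum_distrib_right[symmetric]) (rule mult_right_mono, auto)
  qed
  also have "\<dots> = ennreal ?C * cube_integral (\<lambda>y. ?T' (real b *\<^sub>R y))"
    by (rule nn_integral_cmult) measurable
  also have "cube_integral (\<lambda>y. ?T' (real b *\<^sub>R y)) = ennreal (torus_ball_measure c' r')"
  proof -
    have "surj (\<lambda>y :: real ^ 'm. real b *\<^sub>R y)"
      using b by (intro surjI[of _ "\<lambda>y. (1 / real b) *\<^sub>R y"]) simp
    then show ?thesis
      by (subst cube_integral_linear[OF _ periodic_torus_ball])
        (auto intro: scale linear_scaleR simp: cube_integral_torus_ball)
  qed
  finally have *: "of_nat (b ^ CARD('m)) * cube_integral ?h \<le> ennreal ?C * ennreal (torus_ball_measure c' r')" .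
  have "cube_integral ?h = ennreal (1 / real b ^ CARD('m)) * (of_nat (b ^ CARD('m)) * cube_integral ?h)"
  proof -
    have "ennreal (1 / real b ^ CARD('m)) * of_nat (b ^ CARD('m)) = 1"
      unfolding ennreal_of_nat_eq_real_of_nat using b
      by (subst ennreal_mult[symmetric]) (simp_all)
    then show ?thesis by (simp flip: mult.assoc)
  qed
  also have "\<dots> \<le> ennreal (1 / real b ^ CARD('m)) * (ennreal ?C * ennreal (torus_ball_measure c' r'))"
    by (rule mult_left_mono[OF *]) simp
  also have "\<dots> = ennreal (1 / real b ^ CARD('m) * (?C * torus_ball_measure c' r'))"
  proof -
    have C: "0 \<le> ?C" using r by simp
    note M = torus_ball_measure_nonneg[of c' r']
    show ?thesis
      by (subst ennreal_mult, simp, rule mult_nonneg_nonneg[OF C M], subst ennreal_mult[OF C M], rule refl)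
  qed
  also have "1 / real b ^ CARD('m) * (?C * torus_ball_measure c' r')
      = (min 1 (2 * r) + 1 / real b) ^ CARD('m) * torus_ball_measure c' r'"
  proof -
    have "min 1 (2 * r) + 1 / real b = (min 1 (2 * r) * real b + 1) / real b"
      using b by (simp add: field_simps)
    then show ?thesis by (simp add: power_divide)
  qed
  finally show ?thesis .
qed

text \<open>Choose \<open>t > 0\<close> with \<open>(1 + t) ^ m < 1 + e\<close>. If
  \<open>y \<le> t * x\<close>, then \<open>y\<close> is absorbed into the factor
  \<open>1 + e\<close>; otherwise \<open>x \<le> y / t\<close>, and
  \<open>C = (1 + 1 / t) ^ m\<close> works. This splits an overlap into main term and error.\<close>

lemma add_power_le:
  fixes e :: real
  assumes "e > 0"
  obtains C where "C \<ge> 0" "\<And>x y. x \<ge> 0 \<Longrightarrow> y \<ge> 0 \<Longrightarrow> (x + y) ^ m \<le> (1 + e) * x ^ m + C * y ^ m"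
proof -
  have "((\<lambda>t :: real. (1 + t) ^ m) \<longlongrightarrow> (1 + 0) ^ m) (at_right 0)"
    by (intro tendsto_intros)
  then have "eventually (\<lambda>t :: real. (1 + t) ^ m < 1 + e) (at_right 0)"
    using assms by (intro order_tendstoD) auto
  moreover have "eventually (\<lambda>t :: real. t > 0) (at_right 0)"
    by (simp add: eventually_at_right_less)
  ultimately have "eventually (\<lambda>t :: real. (1 + t) ^ m < 1 + e \<and> t > 0) (at_right 0)"
    by (rule eventually_conj)
  then obtain t :: real where t: "(1 + t) ^ m < 1 + e" "t > 0"
    using eventually_happens trivial_limit_at_right_real by blast
  have "(x + y) ^ m \<le> (1 + e) * x ^ m + (1 + 1 / t) ^ m * y ^ m" if xy: "x \<ge> 0" "y \<ge> 0" for x y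
  proof (cases "y \<le> t * x")
    case True
    have "(x + y) ^ m \<le> ((1 + t) * x) ^ m"
      using True xy by (intro power_mono) (auto simp: algebra_simps)
    also have "\<dots> \<le> (1 + e) * x ^ m"
      unfolding power_mult_distrib using t xy by (intro mult_right_mono) auto
    finally show ?thesis using t xy by (simp add: add_increasing2)
  next
    case False
    then have "x \<le> y / t" using t by (simp add: field_simps)
    then have "(x + y) ^ m \<le> ((1 + 1 / t) * y) ^ m"
      using xy by (intro power_mono) (auto simp: algebra_simps)
    then show ?thesis using assms xy by (simp add: power_mult_distrib add_increasing)
  qed
  then show ?thesis using t by (intro that[of "(1 + 1 / t) ^ m"]) auto
qed

section \<open>Systems of linear forms\<close>

definition lin_form :: "int ^ 'n \<Rightarrow> real ^ 'm ^ 'n \<Rightarrow> real ^ 'm" where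
  "lin_form q x = (\<chi> i. real_of_int (q $ i)) v* x"

lemma lin_form_nth: "lin_form q x $ j = (\<Sum>i\<in>UNIV. real_of_int (q $ i) * x $ i $ j)"
  by (simp add: lin_form_def vector_matrix_mult_def mult.commute)

lemma linear_lin_form: "linear (lin_form q)"
  by (rule linearI)
    (auto simp: vec_eq_iff lin_form_nth algebra_simps sum.distrib sum_distrib_left)

lemma lin_form_axis: "lin_form q (axis i v) = real_of_int (q $ i) *\<^sub>R v"
proof -
  have "lin_form q (axis i v) $ j = (\<Sum>l\<in>UNIV. if l = i then real_of_int (q $ i) * v $ j else 0)" for j
    unfolding lin_form_nth by (intro sum.cong) (auto simp: axis_def)
  then show ?thesis by (simp add: vec_eq_iff)
qed

lemma lin_form_lattice: "k \<in> integer_lattice \<Longrightarrow> lin_form q k \<in> integer_lattice"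
  by (auto simp: lattice_matrix_iff lattice_vec_iff lin_form_nth intro!: Ints_sum)

lemma lin_form_borel [measurable]: "lin_form q \<in> borel_measurable borel"
  using linear_lin_form by (intro borel_measurable_continuous_onI linear_continuous_on)
    (simp add: linear_linear)

lemma surj_lin_form:
  assumes "q \<noteq> 0"
  shows "surj (lin_form q)"
proof -
  obtain i where "q $ i \<noteq> 0" using assms by (auto simp: vec_eq_iff)
  then have "lin_form q (axis i ((1 / real_of_int (q $ i)) *\<^sub>R s)) = s" for s :: "real ^ 'm"
    by (simp add: lin_form_axis)
  then show ?thesis by (rule surjI)
qed

section \<open>Probabilities of target sets and of their intersections\<close>

definition cube_prob :: "'a::euclidean_space measure" where
  "cube_prob = density lborel (indicator ucube)"

lemma sets_cube_prob [simp, measurable_cong]: "sets cube_prob = sets borel"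
  by (simp add: cube_prob_def)

lemma space_cube_prob [simp]: "space cube_prob = UNIV"
  by (simp add: cube_prob_def)

lemma emeasure_cube_prob:
  assumes [measurable]: "A \<in> sets borel"
  shows "emeasure cube_prob A = cube_integral (indicator A)"
  by (simp add: cube_prob_def emeasure_density mult.commute)

lemma emeasure_cube_prob_Int:
  assumes [measurable]: "A \<in> sets borel"
  shows "emeasure cube_prob A = emeasure lborel (ucube \<inter> A)"
  by (simp add: emeasure_cube_prob Int_commute flip: indicator_inter_arith)

interpretation cube_prob: prob_space "cube_prob :: 'a::euclidean_space measure"
  by (rule prob_spaceI) (simp add: emeasure_cube_prob_Int)

definition target_set :: "int ^ 'n \<Rightarrow> real ^ 'm \<Rightarrow> real \<Rightarrow> (real ^ 'm ^ 'n) set" where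
  "target_set q c r = {x. lin_form q x \<in> torus_ball c r}"

lemma open_target_set: "open (target_set q c r)"
proof -
  have "continuous_on UNIV (lin_form q)"
    using linear_lin_form by (intro linear_continuous_on) (simp add: linear_linear)
  then show ?thesis
    using open_vimage[OF open_torus_ball] unfolding target_set_def vimage_def by blast
qed

lemma target_set_borel [measurable]: "target_set q c r \<in> sets borel"
  using open_target_set by (rule borel_open)

lemma indicator_target_set:
  "(indicator (target_set q c r) x :: ennreal) = indicator (torus_ball c r) (lin_form q x)"
  by (simp add: target_set_def indicator_def)

lemma periodic_target_set: "periodic (indicator (target_set q c r))"
  by (simp add: periodic_def target_set_def indicator_def linear_add[OF linear_lin_form]
      torus_ball_add_lattice lin_form_lattice)

text \<open>A nonzero \<open>q\<close> gives a surjective linear map preserving lattices, and such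
  maps preserve cube integrals of periodic functions.\<close>

lemma prob_target_set:
  assumes "q \<noteq> 0"
  shows "measure cube_prob (target_set q c r) = torus_ball_measure c r"
proof -
  have "emeasure cube_prob (target_set q c r) = cube_integral (\<lambda>x. indicator (torus_ball c r) (lin_form q x))"
    by (simp add: emeasure_cube_prob indicator_target_set)
  also have "\<dots> = ennreal (torus_ball_measure c r)"
    by (subst cube_integral_linear[OF _ periodic_torus_ball linear_lin_form lin_form_lattice surj_lin_form[OF assms]])
      (auto simp: cube_integral_torus_ball)
  finally show ?thesis by (simp add: measure_def torus_ball_measure_nonneg)
qed

text \<open>A nonzero 2 by 2 minor makes the two forms linearly independent, so the value of the
  second can be moved at will while the first stays fixed.\<close>

lemma prob_target_set_Int_independent:
  assumes det: "w $ i0 * w' $ i \<noteq> w $ i * w' $ i0"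
  shows "measure cube_prob (target_set w c r \<inter> target_set w' c' r')
    = torus_ball_measure c r * torus_ball_measure c' r'"
proof -
  have w: "w \<noteq> 0" using det by auto
  define D where "D = real_of_int (w $ i0) * real_of_int (w' $ i) - real_of_int (w $ i) * real_of_int (w' $ i0)"
  have "D = real_of_int (w $ i0 * w' $ i - w $ i * w' $ i0)" by (simp add: D_def)
  then have D: "D \<noteq> 0" using det by (simp only: of_int_eq_0_iff right_minus_eq not_False_eq_True)
  have shift: "\<exists>t. lin_form w' t = s \<and>
      (\<forall>x. (indicator (target_set w c r) (x + t) :: ennreal) = indicator (target_set w c r) x)" for s
  proof (intro exI conjI allI)
    \<comment> \<open>Cramer's rule on the rows \<open>i\<close> and \<open>i0\<close>, for the
      value 0 of the form of \<open>w\<close> and the value \<open>s\<close> of the form of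
      \<open>w'\<close>.\<close>
    let ?t = "axis i ((real_of_int (w $ i0) / D) *\<^sub>R s) - axis i0 ((real_of_int (w $ i) / D) *\<^sub>R s)"
    have "lin_form w' ?t = ((real_of_int (w $ i0) * real_of_int (w' $ i)
        - real_of_int (w $ i) * real_of_int (w' $ i0)) / D) *\<^sub>R s"
      by (simp add: linear_diff[OF linear_lin_form] lin_form_axis diff_divide_distrib mult.commute scaleR_diff_left)
    also have "\<dots> = s" using D by (simp flip: D_def)
    finally show "lin_form w' ?t = s" .
    have "lin_form w ?t = 0"
      by (simp add: linear_diff[OF linear_lin_form] lin_form_axis mult.commute)
    then show "(indicator (target_set w c r) (x + ?t) :: ennreal) = indicator (target_set w c r) x" for x
      by (simp only: indicator_target_set linear_add[OF linear_lin_form] add_0_right)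
  qed
  have "emeasure cube_prob (target_set w c r \<inter> target_set w' c' r')
      = cube_integral (\<lambda>x. indicator (target_set w c r) x * indicator (torus_ball c' r') (lin_form w' x))"
    by (simp add: emeasure_cube_prob indicator_inter_arith indicator_target_set[of w'])
  also have "\<dots> = cube_integral (indicator (target_set w c r)) * cube_integral (indicator (torus_ball c' r'))"
    by (rule cube_integral_mult_linear[OF _ _ periodic_target_set periodic_torus_ball
          linear_lin_form lin_form_lattice shift]) auto
  also have "cube_integral (indicator (target_set w c r)) = ennreal (torus_ball_measure c r)"
    by (simp add: cube_prob.emeasure_eq_measure prob_target_set[OF w] flip: emeasure_cube_prob)
  finally show ?thesis
    by (simp add: measure_def torus_ball_measure_nonneg cube_integral_torus_ball enn2real_mult)
qed

text \<open>Both forms are multiples of \<open>lin_form u\<close>, which preserves cube integrals,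
  so the overlap is that of two coprime dilates on the torus.\<close>

lemma prob_target_set_Int_parallel:
  fixes c c' :: "real ^ 'm" and u :: "int ^ 'n"
  assumes w: "\<And>i. w $ i = int b * u $ i" and w': "\<And>i. w' $ i = int a * u $ i"
    and cop: "coprime a b" and b: "b > 0" and r: "r > 0" and u: "u \<noteq> 0"
  shows "measure cube_prob (target_set w' c r \<inter> target_set w c' r')
    \<le> (min 1 (2 * r) + 1 / real b) ^ CARD('m) * torus_ball_measure c' r'"
proof -
  let ?h = "\<lambda>y. indicator (torus_ball c r) (real a *\<^sub>R y) * indicator (torus_ball c' r') (real b *\<^sub>R y) :: ennreal"
  have lin: "lin_form w x = real b *\<^sub>R lin_form u x" "lin_form w' x = real a *\<^sub>R lin_form u x"
    for x :: "real ^ 'm ^ 'n"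
    by (simp_all add: vec_eq_iff lin_form_nth w w' sum_distrib_left mult.assoc)
  have scale: "real d *\<^sub>R k \<in> integer_lattice" if "k \<in> integer_lattice" for d :: nat and k :: "real ^ 'm"
    using that by (auto simp: lattice_vec_iff)
  have perh: "periodic ?h"
    using scale by (auto simp: periodic_def scaleR_add_right indicator_def torus_ball_add_lattice)
  have "emeasure cube_prob (target_set w' c r \<inter> target_set w c' r') = cube_integral (\<lambda>x. ?h (lin_form u x))"
    by (simp add: emeasure_cube_prob indicator_inter_arith indicator_target_set lin)
  also have "\<dots> = cube_integral ?h"
    by (rule cube_integral_linear[OF _ perh linear_lin_form lin_form_lattice surj_lin_form[OF u]]) measurable
  also have "\<dots> \<le> ennreal ((min 1 (2 * r) + 1 / real b) ^ CARD('m) * torus_ball_measure c' r')"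
    by (rule torus_ball_overlap_coprime[OF cop b r])
  finally show ?thesis
    using r by (simp add: cube_prob.emeasure_eq_measure ennreal_le_iff torus_ball_measure_nonneg)
qed

section \<open>The limsup set and its measure\<close>

definition limsup_targets :: "(nat \<Rightarrow> (real ^ 'm) \<times> real) \<Rightarrow> (real ^ 'm ^ 'n) set" where
  "limsup_targets B = {x. infinite {q. q \<noteq> 0 \<and> x \<in> target_set q (fst (B (qnorm q))) (snd (B (qnorm q)))}}"

lemma A_set_eq: "A_set B = cbox 0 One \<inter> limsup_targets B"
  by (auto simp: A_set_def limsup_targets_def target_set_def lin_form_def)

lemma qnorm_eq_0_iff: "qnorm q = 0 \<longleftrightarrow> q = 0"
  by (auto simp: qnorm_def vec_eq_iff Max_eq_iff)

lemma finite_qnorm_le: "finite {q :: int ^ 'n. qnorm q \<le> N}"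
proof -
  have "{q :: int ^ 'n. qnorm q \<le> N} = {0} \<union> (\<Union>k\<in>{1..N}. {q. qnorm q = k})"
    by (auto simp: Suc_le_eq qnorm_eq_0_iff[THEN iffD2]) (metis gr0I qnorm_eq_0_iff)
  then show ?thesis by (simp add: card_qnorm_le(1))
qed

text \<open>Only finitely many \<open>q\<close> have bounded norm, so infinitely many hits mean hits
  of arbitrarily large norm: a countable intersection of open sets.\<close>

lemma limsup_targets_borel [measurable]:
  "(limsup_targets B :: (real ^ 'm ^ 'n) set) \<in> sets borel"
proof -
  let ?T = "\<lambda>q. target_set q (fst (B (qnorm q))) (snd (B (qnorm q))) :: (real ^ 'm ^ 'n) set"
  have inf: "infinite {q :: int ^ 'n. q \<noteq> 0 \<and> x \<in> ?T q} \<longleftrightarrow> (\<forall>N. \<exists>q. q \<noteq> 0 \<and> qnorm q > N \<and> x \<in> ?T q)" for x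
  proof
    assume i: "infinite {q. q \<noteq> 0 \<and> x \<in> ?T q}"
    show "\<forall>N. \<exists>q. q \<noteq> 0 \<and> qnorm q > N \<and> x \<in> ?T q"
    proof (rule ccontr)
      assume "\<not> (\<forall>N. \<exists>q. q \<noteq> 0 \<and> qnorm q > N \<and> x \<in> ?T q)"
      then obtain N where "{q. q \<noteq> 0 \<and> x \<in> ?T q} \<subseteq> {q. qnorm q \<le> N}" by (auto simp: not_less)
      then show False using i finite_qnorm_le finite_subset by blast
    qed
  next
    assume a: "\<forall>N. \<exists>q. q \<noteq> 0 \<and> qnorm q > N \<and> x \<in> ?T q"
    show "infinite {q. q \<noteq> 0 \<and> x \<in> ?T q}"
    proof
      assume "finite {q. q \<noteq> 0 \<and> x \<in> ?T q}"
      then have "finite (qnorm ` {q. q \<noteq> 0 \<and> x \<in> ?T q})" by simp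
      then obtain N where "\<forall>k\<in>qnorm ` {q. q \<noteq> 0 \<and> x \<in> ?T q}. k \<le> N"
        using finite_nat_set_iff_bounded_le by blast
      then show False using a by (metis (mono_tags, lifting) imageI mem_Collect_eq not_less)
    qed
  qed
  have "(limsup_targets B :: (real ^ 'm ^ 'n) set) = (\<Inter>N. \<Union>q\<in>{q. q \<noteq> 0 \<and> qnorm q > N}. ?T q)"
    unfolding limsup_targets_def inf by auto
  moreover have "(\<Union>q\<in>{q :: int ^ 'n. q \<noteq> 0 \<and> qnorm q > N}. ?T q :: (real ^ 'm ^ 'n) set) \<in> sets borel" for N
    by (intro borel_open open_UN ballI open_target_set)
  ultimately show ?thesis by (simp only:) (intro sets.countable_INT, auto)
qed

text \<open>The closed and the half-open unit cube differ by a null set.\<close>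

lemma emeasure_A_set:
  "emeasure lebesgue (A_set B :: (real ^ 'm ^ 'n) set) = emeasure cube_prob (limsup_targets B :: (real ^ 'm ^ 'n) set)"
proof -
  let ?G = "limsup_targets B :: (real ^ 'm ^ 'n) set"
  have "emeasure lborel (cbox 0 One - ucube :: (real ^ 'm ^ 'n) set) = 0"
    using ucube_subset_cbox by (subst emeasure_Diff) (auto simp: emeasure_lborel_cbox_eq)
  then have "cbox 0 One - ucube \<in> null_sets (lborel :: (real ^ 'm ^ 'n) measure)" by auto
  then have "AE x in lborel. x \<notin> (cbox 0 One - ucube :: (real ^ 'm ^ 'n) set)" by (rule AE_not_in)
  then have "AE x in lborel. x \<in> cbox 0 One \<inter> ?G \<longleftrightarrow> x \<in> ucube \<inter> ?G"
    by eventually_elim (use ucube_subset_cbox in auto)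
  then have "emeasure lborel (cbox 0 One \<inter> ?G) = emeasure lborel (ucube \<inter> ?G)"
    by (rule emeasure_eq_AE) auto
  then show ?thesis by (simp add: A_set_eq emeasure_cube_prob_Int)
qed

text \<open>The convergent Borel-Cantelli lemma, applied to the unions of the target sets over all
  vectors of a given norm.\<close>

lemma limsup_targets_null:
  fixes B :: "nat \<Rightarrow> (real ^ 'm) \<times> real"
  assumes sum: "summable (\<lambda>q. real (Suc q) ^ (CARD('n) - 1) * torus_ball_measure (fst (B (Suc q))) (snd (B (Suc q))))"
  shows "emeasure cube_prob (limsup_targets B :: (real ^ 'm ^ 'n) set) = 0"
proof -
  let ?\<mu> = "\<lambda>k. torus_ball_measure (fst (B k)) (snd (B k))"
  let ?T = "\<lambda>q :: int ^ 'n. target_set q (fst (B (qnorm q))) (snd (B (qnorm q))) :: (real ^ 'm ^ 'n) set"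
  let ?Q = "\<lambda>k. {q :: int ^ 'n. qnorm q = k}"
  \<comment> \<open>Shifted by one like the series; norm 0, that is \<open>q = 0\<close>, is left
    out.\<close>
  define A where "A k = (\<Union>q\<in>?Q (Suc k). ?T q)" for k
  let ?K = "real (2 * CARD('n) * 3 ^ (CARD('n) - 1))"
  have A [measurable]: "A k \<in> sets borel" for k
    unfolding A_def by (intro borel_open open_UN ballI open_target_set)
  have le: "measure cube_prob (A k) \<le> ?K * (real (Suc k) ^ (CARD('n) - 1) * ?\<mu> (Suc k))" for k
  proof -
    have "measure cube_prob (A k) \<le> (\<Sum>q\<in>?Q (Suc k). measure cube_prob (?T q))"
      unfolding A_def by (intro cube_prob.finite_measure_subadditive_finite card_qnorm_le(1)) auto
    also have "\<dots> = (\<Sum>q\<in>?Q (Suc k). ?\<mu> (Suc k))"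
      by (intro sum.cong prob_target_set[THEN trans]) (auto simp flip: qnorm_eq_0_iff)
    also have "\<dots> = real (card (?Q (Suc k))) * ?\<mu> (Suc k)" by simp
    also have "\<dots> \<le> real (2 * CARD('n) * 3 ^ (CARD('n) - 1) * Suc k ^ (CARD('n) - 1)) * ?\<mu> (Suc k)"
      by (intro mult_right_mono of_nat_mono card_qnorm_le(2) torus_ball_measure_nonneg) simp
    finally show ?thesis by (simp only: of_nat_mult of_nat_power mult.assoc)
  qed
  have "summable (\<lambda>k. measure cube_prob (A k))"
    by (rule summable_comparison_test'[OF summable_mult[OF sum, of ?K]]) (use le in auto)
  then have "AE x in cube_prob. eventually (\<lambda>n. x \<in> space cube_prob - A n) sequentially"
    by (intro borel_cantelli_AE1) (auto simp: cube_prob.emeasure_eq_measure)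
  then have "AE x in cube_prob. x \<notin> (limsup_targets B :: (real ^ 'm ^ 'n) set)"
  proof (rule AE_mp, intro AE_I2 impI)
    fix x assume "eventually (\<lambda>n. x \<in> space cube_prob - A n) sequentially"
    then obtain N where N: "\<And>n. n \<ge> N \<Longrightarrow> x \<notin> A n" by (auto simp: eventually_sequentially)
    have "{q. q \<noteq> 0 \<and> x \<in> ?T q} \<subseteq> {q. qnorm q \<le> N}"
    proof clarify
      fix q :: "int ^ 'n" assume q: "q \<noteq> 0" "x \<in> ?T q"
      then obtain k where k: "qnorm q = Suc k" by (metis not0_implies_Suc qnorm_eq_0_iff)
      then have "x \<in> A k" using q(2) unfolding A_def by blast
      then have "k < N" using N by (meson not_le)
      then show "qnorm q \<le> N" using k by simp
    qed
    then show "x \<notin> (limsup_targets B :: (real ^ 'm ^ 'n) set)" using finite_qnorm_le finite_subset by (auto simp: limsup_targets_def)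
  qed
  then show ?thesis by (subst (asm) AE_iff_measurable[OF _ refl]) auto
qed

section \<open>The divergence case\<close>

lemma limsup_targets_full:
  fixes B :: "nat \<Rightarrow> (real ^ 'm) \<times> real"
  assumes nm: "CARD('n) + CARD('m) \<ge> 4"
    and div: "\<not> summable (\<lambda>q. real (Suc q) ^ (CARD('n) - 1) * torus_ball_measure (fst (B (Suc q))) (snd (B (Suc q))))"
  shows "emeasure cube_prob (limsup_targets B :: (real ^ 'm ^ 'n) set) = 1"
proof -
  define \<mu> where "\<mu> k = torus_ball_measure (fst (B k)) (snd (B k))" for k
  have \<mu>0: "\<mu> k \<ge> 0" for k by (simp add: \<mu>_def torus_ball_measure_nonneg)
  \<comment> \<open>Any coordinate can serve as the distinguished one.\<close>
  define i0 :: 'n where "i0 = undefined"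
  let ?n = "CARD('n) - 1" and ?m = "CARD('m)"
  define T where "T = (\<lambda>(k, w). target_set w (fst (B k)) (snd (B k)) :: (real ^ 'm ^ 'n) set)"
  define F where "F N = (SIGMA k:{1..N}. slab i0 k)" for N
  define S where "S N = (\<Sum>p\<in>F N. measure cube_prob (T p))" for N
  have F: "b > 0" "w \<in> slab i0 b" "w $ i0 = int b" "w \<noteq> 0" if "(b, w) \<in> F N" for b w N
  proof -
    show b: "b > 0" and w: "w \<in> slab i0 b" using that by (auto simp: F_def)
    show "w $ i0 = int b" using w by (rule slab_nth)
    then show "w \<noteq> 0" using b by auto
  qed
  have probT: "measure cube_prob (T (b, w)) = \<mu> b" if "(b, w) \<in> F N" for b w N
    using prob_target_set[OF F(4)[OF that]] by (simp add: T_def \<mu>_def)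
  have S\<mu>: "S N = (\<Sum>p\<in>F N. \<mu> (fst p))" for N
    unfolding S_def by (intro sum.cong) (auto simp: probT)
  have sumF: "(\<Sum>p\<in>F N. f p) = (\<Sum>b=1..N. \<Sum>w\<in>slab i0 b. f (b, w))" for N and f :: "_ \<Rightarrow> real"
    unfolding F_def
    using sum.Sigma[of "{1..N}" "slab i0" "\<lambda>b w. f (b, w)"] by (simp add: case_prod_beta)
  have S: "S N = (\<Sum>k=1..N. real k ^ ?n * \<mu> k)" for N
    by (simp add: S\<mu> sumF card_slab)
  \<comment> \<open>Bounded partial sums of a nonnegative series would make it summable.\<close>
  have lim: "filterlim S at_top sequentially"
  proof -
    have S': "S N = (\<Sum>k<N. real (Suc k) ^ ?n * \<mu> (Suc k))" for N
      unfolding S by (rule sum.reindex_bij_witness[of _ Suc "\<lambda>k. k - 1"]) auto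
    show ?thesis
      unfolding S' filterlim_at_top
    proof (rule ccontr)
      assume "\<not> (\<forall>Z. eventually (\<lambda>N. Z \<le> (\<Sum>k<N. real (Suc k) ^ ?n * \<mu> (Suc k))) sequentially)"
      then obtain Z where Z: "\<And>M. \<exists>N\<ge>M. (\<Sum>k<N. real (Suc k) ^ ?n * \<mu> (Suc k)) < Z"
        by (auto simp: eventually_sequentially not_le)
      have "(\<Sum>k<M. real (Suc k) ^ ?n * \<mu> (Suc k)) \<le> Z" for M
      proof -
        obtain N where N: "N \<ge> M" "(\<Sum>k<N. real (Suc k) ^ ?n * \<mu> (Suc k)) < Z" using Z by blast
        have "(\<Sum>k<M. real (Suc k) ^ ?n * \<mu> (Suc k)) \<le> (\<Sum>k<N. real (Suc k) ^ ?n * \<mu> (Suc k))"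
          using N(1) \<mu>0 by (intro sum_mono2) auto
        then show ?thesis using N(2) by simp
      qed
      then have "summable (\<lambda>k. real (Suc k) ^ ?n * \<mu> (Suc k))"
        using \<mu>0 by (intro summableI_nonneg_bounded) auto
      then show False using div by (simp add: \<mu>_def)
    qed
  qed
  \<comment> \<open>Up to a constant, the excess over the independent main term in the overlap of a
    parallel pair, charged to the vector of larger norm \<open>b\<close>.\<close>
  define R where "R = (\<lambda>(b, w :: int ^ 'n) (a, w'). if a < b \<and> parallel_vecs w b w' a
      then \<mu> b * (real (gcd a b) / real b) ^ ?m else 0)"
  have R0: "R p p' \<ge> 0" for p p' by (auto simp: R_def \<mu>0 split: prod.split)
  have sumR: "(\<Sum>p\<in>F N. \<Sum>p'\<in>F N. R p p') \<le> 2 * S N" for N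
  proof -
    have "(\<Sum>p\<in>F N. \<Sum>p'\<in>F N. R p p')
        = (\<Sum>b=1..N. \<Sum>w\<in>slab i0 b. \<Sum>a=1..N. \<Sum>w'\<in>slab i0 a. R (b, w) (a, w'))"
      by (simp only: sumF)
    also have "\<dots> \<le> (\<Sum>b=1..N. \<mu> b * (2 * real b ^ ?n))"
    proof (rule sum_mono)
      fix b assume b: "b \<in> {1..N}"
      have "(\<Sum>a=1..N. \<Sum>w'\<in>slab i0 a. R (b, w) (a, w')) = \<mu> b * (\<Sum>a=1..<b. \<Sum>w'\<in>slab i0 a.
          if parallel_vecs w b w' a then (real (gcd a b) / real b) ^ ?m else 0)" for w
      proof -
        have "(\<Sum>a=1..N. \<Sum>w'\<in>slab i0 a. R (b, w) (a, w')) = (\<Sum>a=1..<b. \<Sum>w'\<in>slab i0 a. R (b, w) (a, w'))"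
          using b by (intro sum.mono_neutral_right) (auto simp: R_def)
        also have "\<dots> = (\<Sum>a=1..<b. \<Sum>w'\<in>slab i0 a.
            \<mu> b * (if parallel_vecs w b w' a then (real (gcd a b) / real b) ^ ?m else 0))"
          by (intro sum.cong) (auto simp: R_def)
        finally show ?thesis by (simp only: sum_distrib_left)
      qed
      then have "(\<Sum>w\<in>slab i0 b. \<Sum>a=1..N. \<Sum>w'\<in>slab i0 a. R (b, w) (a, w')) = \<mu> b * (\<Sum>w\<in>slab i0 b. \<Sum>a=1..<b. \<Sum>w'\<in>slab i0 a.
          if parallel_vecs w b w' a then (real (gcd a b) / real b) ^ ?m else 0)"
        by (simp only: sum_distrib_left)
      also have "\<dots> \<le> \<mu> b * (2 * real b ^ ?n)"
        using b nm by (intro mult_left_mono sum_parallel_le \<mu>0) auto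
      finally show "(\<Sum>w\<in>slab i0 b. \<Sum>a=1..N. \<Sum>w'\<in>slab i0 a. R (b, w) (a, w')) \<le> \<mu> b * (2 * real b ^ ?n)" .
    qed
    also have "\<dots> = 2 * S N" by (simp add: S sum_distrib_left mult_ac)
    finally show ?thesis .
  qed
  have overlap: "\<exists>C. \<forall>N. (\<Sum>p\<in>F N. \<Sum>p'\<in>F N. measure cube_prob (T p \<inter> T p')) \<le> (1 + e) * (S N)\<^sup>2 + C * S N"
    if e: "e > 0" for e
  proof -
    obtain C where C: "C \<ge> 0" "\<And>x y. x \<ge> 0 \<Longrightarrow> y \<ge> 0 \<Longrightarrow> (x + y) ^ ?m \<le> (1 + e) * x ^ ?m + C * y ^ ?m"
      using add_power_le[OF e] by blast
    have par: "measure cube_prob (T (b, w) \<inter> T (a, w')) \<le> (1 + e) * (\<mu> b * \<mu> a) + C * R (b, w) (a, w')"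
      if p: "(b, w) \<in> F N" "(a, w') \<in> F N" and ab: "a < b" "parallel_vecs w b w' a" for b w a w' N
    proof (cases "snd (B a) > 0")
      case False
      \<comment> \<open>The radii are arbitrary reals, so empty balls may occur.\<close>
      then have "T (a, w') = {}" by (simp add: T_def target_set_def torus_ball_empty)
      then show ?thesis using e C(1) \<mu>0 R0 by simp
    next
      case True
      let ?g = "gcd a b" and ?\<alpha> = "min 1 (2 * snd (B a))"
      obtain u where u: "\<And>i. w $ i = int (b div ?g) * u $ i" "\<And>i. w' $ i = int (a div ?g) * u $ i"
        using parallel_common_factor[OF ab(2) F(1)[OF p(1)]] by blast
      have u0: "u \<noteq> 0" using u(1) F(4)[OF p(1)] by (auto simp: vec_eq_iff)
      have b: "b > 0" using F(1)[OF p(1)] .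
      have cop: "coprime (a div ?g) (b div ?g)" using b by (simp add: div_gcd_coprime)
      have b': "b div ?g > 0" using b by (simp add: div_greater_zero_iff gcd_le2_nat)
      have gb: "1 / real (b div ?g) = real ?g / real b" by (simp add: real_of_nat_div)
      have "measure cube_prob (T (b, w) \<inter> T (a, w')) \<le> (?\<alpha> + 1 / real (b div ?g)) ^ ?m * \<mu> b"
        using prob_target_set_Int_parallel[OF u cop b' True u0, of "fst (B a)" "fst (B b)" "snd (B b)"]
        by (simp add: T_def \<mu>_def Int_commute)
      also have "\<dots> \<le> ((1 + e) * ?\<alpha> ^ ?m + C * (real ?g / real b) ^ ?m) * \<mu> b"
        unfolding gb using True by (intro mult_right_mono C(2) \<mu>0) auto
      \<comment> \<open>The power of the arc length is at most the measure of the ball, which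
        restores the main term of independent sets.\<close>
      also have "\<dots> \<le> ((1 + e) * \<mu> a + C * (real ?g / real b) ^ ?m) * \<mu> b"
        using e torus_ball_measure_ge[OF True, of "fst (B a)"] \<mu>0
        by (intro mult_right_mono add_mono mult_left_mono) (auto simp: \<mu>_def)
      also have "\<dots> = (1 + e) * (\<mu> b * \<mu> a) + C * R (b, w) (a, w')"
        using ab by (simp add: R_def algebra_simps)
      finally show ?thesis .
    qed
    have bound: "measure cube_prob (T p \<inter> T p') \<le>
        (1 + e) * (\<mu> (fst p) * \<mu> (fst p')) + C * (R p p' + R p' p) + (if p' = p then \<mu> (fst p) else 0)"
      if p: "p \<in> F N" "p' \<in> F N" for p p' N
    proof -
      obtain b w a w' where eq: "p = (b, w)" "p' = (a, w')" by (cases p, cases p') auto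
      note p = p[unfolded eq]
      have CR: "C * R x y \<ge> 0" for x y using C(1) R0 by simp
      have \<mu>\<mu>: "\<mu> b * \<mu> a \<le> (1 + e) * (\<mu> b * \<mu> a)"
        using e mult_nonneg_nonneg[OF \<mu>0 \<mu>0, of b a] by (simp add: algebra_simps)
      have \<mu>\<mu>0: "0 \<le> \<mu> b * \<mu> a" using \<mu>0 by simp
      \<comment> \<open>Parallel vectors of equal norm in the slabs coincide, so off the diagonal a
        parallel pair has distinct norms.\<close>
      consider "p' = p" | "\<not> parallel_vecs w b w' a" | "parallel_vecs w b w' a" "a < b" | "parallel_vecs w b w' a" "b < a"
      proof (cases "parallel_vecs w b w' a \<and> a = b")
        case True
        then have "w = w'" using F(1)[OF p(1)] by (auto simp: parallel_vecs_def vec_eq_iff)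
        then show ?thesis using that(1) True eq by simp
      qed (use that in linarith)
      then show ?thesis
      proof cases
        case 1
        then show ?thesis using probT[OF p(1)] eq CR[of p p'] CR[of p' p] \<mu>\<mu> \<mu>\<mu>0
          by (simp add: algebra_simps)
      next
        case 2
        then obtain i where "int a * w $ i \<noteq> int b * w' $ i" by (auto simp: parallel_vecs_def)
        \<comment> \<open>The distinguished coordinates are \<open>b\<close> and \<open>a\<close>,
          so failure of proportionality is a nonzero minor.\<close>
        then have "w $ i0 * w' $ i \<noteq> w $ i * w' $ i0"
          using F(3)[OF p(1)] F(3)[OF p(2)] by (simp add: mult.commute)
        from prob_target_set_Int_independent[OF this, of "fst (B b)" "snd (B b)" "fst (B a)" "snd (B a)"]
        have "measure cube_prob (T p \<inter> T p') = \<mu> b * \<mu> a" by (simp add: T_def \<mu>_def eq)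
        then show ?thesis using \<mu>\<mu> CR[of p p'] CR[of p' p] \<mu>0[of b] by (simp add: eq algebra_simps)
      next
        case 3
        then show ?thesis using par[OF p 3(2,1)] CR[of p' p] \<mu>0[of b] by (simp add: eq algebra_simps)
      next
        case 4
        then have "parallel_vecs w' a w b" by (simp add: parallel_vecs_def)
        then show ?thesis using par[OF p(2,1) 4(2)] CR[of p p'] \<mu>0[of b] 4(2)
          by (simp add: eq algebra_simps Int_commute)
      qed
    qed
    \<comment> \<open>\<open>R\<close> enters in both orders, each with sum at most
      \<open>2 * S N\<close>, whence \<open>4 * C\<close>; the diagonal gives one more
      \<open>S N\<close>.\<close>
    have "(\<Sum>p\<in>F N. \<Sum>p'\<in>F N. measure cube_prob (T p \<inter> T p')) \<le> (1 + e) * (S N)\<^sup>2 + (4 * C + 1) * S N" for N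
    proof -
      have finF: "finite (F N)" by (simp add: F_def)
      have "(\<Sum>p\<in>F N. \<Sum>p'\<in>F N. measure cube_prob (T p \<inter> T p'))
        \<le> (\<Sum>p\<in>F N. \<Sum>p'\<in>F N. (1 + e) * (\<mu> (fst p) * \<mu> (fst p')) + C * (R p p' + R p' p)
            + (if p' = p then \<mu> (fst p) else 0))"
        by (intro sum_mono bound)
      also have "\<dots> = (1 + e) * (\<Sum>p\<in>F N. \<Sum>p'\<in>F N. \<mu> (fst p) * \<mu> (fst p'))
          + C * ((\<Sum>p\<in>F N. \<Sum>p'\<in>F N. R p p') + (\<Sum>p\<in>F N. \<Sum>p'\<in>F N. R p' p)) + (\<Sum>p\<in>F N. \<mu> (fst p))"
        using finF by (simp add: sum.distrib sum_distrib_left distrib_left)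
      also have "(\<Sum>p\<in>F N. \<Sum>p'\<in>F N. R p' p) = (\<Sum>p\<in>F N. \<Sum>p'\<in>F N. R p p')"
        by (rule sum.swap)
      also have "(\<Sum>p\<in>F N. \<Sum>p'\<in>F N. \<mu> (fst p) * \<mu> (fst p')) = (S N)\<^sup>2"
        by (simp add: S\<mu> power2_eq_square sum_product)
      also have "(\<Sum>p\<in>F N. \<mu> (fst p)) = S N" by (simp add: S\<mu>)
      also have "(1 + e) * (S N)\<^sup>2 + C * ((\<Sum>p\<in>F N. \<Sum>p'\<in>F N. R p p') + (\<Sum>p\<in>F N. \<Sum>p'\<in>F N. R p p')) + S N
          \<le> (1 + e) * (S N)\<^sup>2 + C * (2 * S N + 2 * S N) + S N"
        using e C(1) sumR[of N] by (intro add_mono mult_left_mono) auto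
      also have "\<dots> = (1 + e) * (S N)\<^sup>2 + (4 * C + 1) * S N" by (simp add: algebra_simps)
      finally show ?thesis .
    qed
    then show ?thesis by blast
  qed
  have "AE x in cube_prob. infinite {p \<in> (\<Union>N. F N). x \<in> T p}"
    by (rule cube_prob.AE_infinite_of_quasi_independent[OF _ _ S_def lim overlap])
      (auto simp: F_def T_def)
  then have "AE x in cube_prob. x \<in> (limsup_targets B :: (real ^ 'm ^ 'n) set)"
  proof eventually_elim
    case (elim x)
    let ?P = "{p \<in> (\<Union>N. F N). x \<in> T p}"
    let ?Q = "{q :: int ^ 'n. q \<noteq> 0 \<and> x \<in> target_set q (fst (B (qnorm q))) (snd (B (qnorm q)))}"
    \<comment> \<open>A vector determines its norm through the coordinate \<open>i0\<close>, so
      distinct hits come from distinct vectors.\<close>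
    have "inj_on snd ?P" by (auto simp: inj_on_def) (metis F(3) of_nat_eq_iff)
    moreover have "snd ` ?P \<subseteq> ?Q"
      by (auto simp: T_def dest: F(4)) (metis F(2) qnorm_slab)
    ultimately have "infinite ?Q" using elim by (meson finite_imageD finite_subset)
    then show ?case by (simp add: limsup_targets_def)
  qed
  then show ?thesis by (intro cube_prob.emeasure_eq_1_AE) auto
qed

theorem theorem2:
  fixes B :: "nat \<Rightarrow> (real ^ 'm) \<times> real"
  assumes "CARD('n) * CARD('m) > 2"
  shows "A_set B \<in> sets (lebesgue :: (real ^ 'm ^ 'n) measure)
     \<and> ((summable (\<lambda>q. real (Suc q) ^ (CARD('n) - 1) * torus_ball_measure (fst (B (Suc q))) (snd (B (Suc q)))))
          \<longrightarrow> emeasure lebesgue (A_set B :: (real ^ 'm ^ 'n) set) = 0)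
     \<and> ((\<not> summable (\<lambda>q. real (Suc q) ^ (CARD('n) - 1) * torus_ball_measure (fst (B (Suc q))) (snd (B (Suc q)))))
          \<longrightarrow> emeasure lebesgue (A_set B :: (real ^ 'm ^ 'n) set) = 1)"
proof -
  \<comment> \<open>The pairs with sum below 4 are (1,1), (1,2) and (2,1), exactly those with
    product at most 2.\<close>
  have "4 \<le> CARD('n) + CARD('m)"
  proof (rule ccontr)
    assume "\<not> 4 \<le> CARD('n) + CARD('m)"
    moreover have "CARD('n) \<ge> 1" "CARD('m) \<ge> 1" by (simp_all add: Suc_leI)
    ultimately have "CARD('n) = 1 \<and> CARD('m) \<le> 2 \<or> CARD('n) = 2 \<and> CARD('m) = 1" by linarith
    then show False using assms by auto
  qed
  moreover have "A_set B \<in> sets (lebesgue :: (real ^ 'm ^ 'n) measure)"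
    by (simp add: A_set_eq)
  ultimately show ?thesis
    using limsup_targets_null[of B, where ?'n = 'n] limsup_targets_full[of B, where ?'n = 'n] by (simp add: emeasure_A_set)
qed

end
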